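(* For each $n$ let $m(i/n)=m_n(i/n)\ge 0$, $1\le i\le n$, be real numbers (possibly depending on $n$ as well as on $i/n$) with $$\lim_{n\to\infty}\min_{1\le i\le n}m(i/n)=\infty\quad\text{and}\quad\lim_{n\to\infty}\frac{\max_{1\le i\le n}m(i/n)}{\log\log n}=0,$$ and suppose that for every sufficiently large $n$ the correlation coefficients of the array satisfy $\rho_{ni}=1-\frac{m(i/n)}{\log n}$ for $1\le i\le n$. Let $$G_n(x,y)=\mathbb{P}\Big(n\big(\max_{1\le i\le n}F_1(X_{ni})-1\big)\le x,\ n\big(\max_{1\le i\le n}F_2(Y_{ni})-1\big)\le y\Big).$$ Then for any $x<0$ and $y<0$, $$\lim_{n\to\infty}\left(\frac1n\sum_{i=1}^n\frac{\exp\left(-m(i/n)/2\right)}{\sqrt{m(i/n)}}\right)^{-1}\Big[G_n(x,y)-e^{x+y}\Big]=\sqrt{\frac{2}{\pi}}\,(xy)^{\frac12}\,e^{x+y}.$$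
   Context: $\Phi$ is the standard normal distribution function and $\Phi^{-}$ its inverse. For $\rho\in(-1,1)$ the normal copula $C(\cdot,\cdot;\rho)$ is the distribution function on $(0,1)^2$ with density $$c(u,v;\rho)=\frac{1}{\sqrt{1-\rho^2}}\exp\left(\frac{2\rho\,\Phi^{-}(u)\Phi^{-}(v)-\rho^2(\Phi^{-}(u))^2-\rho^2(\Phi^{-}(v))^2}{2(1-\rho^2)}\right).$$ Setting (dynamic bivariate normal copula): $F_1,F_2$ are continuous distribution functions on the real line. For each (sufficiently large) $n$, $(X_{n1},Y_{n1}),\dots,(X_{nn},Y_{nn})$ are independent bivariate random vectors; for each $i$, $X_{ni}$ has distribution function $F_1$, $Y_{ni}$ has distribution function $F_2$, and the copula of $(X_{ni},Y_{ni})$ is the normal copula $C(\cdot,\cdot;\rho_{ni})$, i.e. $(F_1(X_{ni}),F_2(Y_{ni}))$ has density $c(\cdot,\cdot;\rho_{ni})$. The correlation coefficients $\rho_{ni}$ may depend on both $i$ and $n$; $n$ is taken large enough that $\rho_{ni}\in(-1,1)$. *)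

theory Defs
  imports "HOL-Probability.Probability"
begin

definition std_normal_cdf :: "real \<Rightarrow> real" where
  "std_normal_cdf = cdf std_normal_distribution"

text \<open>Only meaningful on the open unit interval, the range of the standard normal
  distribution function.\<close>
definition std_normal_quantile :: "real \<Rightarrow> real" where
  "std_normal_quantile = inv std_normal_cdf"

text \<open>The density is extended by zero outside the open unit square.\<close>
definition normal_copula_density :: "real \<Rightarrow> real \<times> real \<Rightarrow> real" where
  "normal_copula_density \<rho> = (\<lambda>(u, v).
     if 0 < u \<and> u < 1 \<and> 0 < v \<and> v < 1 then
       1 / sqrt (1 - \<rho>\<^sup>2) *
       exp ((2 * \<rho> * std_normal_quantile u * std_normal_quantile v
              - \<rho>\<^sup>2 * (std_normal_quantile u)\<^sup>2 - \<rho>\<^sup>2 * (std_normal_quantile v)\<^sup>2)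
            / (2 * (1 - \<rho>\<^sup>2)))
     else 0)"

definition continuous_distribution_function :: "(real \<Rightarrow> real) \<Rightarrow> bool" where
  "continuous_distribution_function F \<longleftrightarrow>
     mono F \<and> continuous_on UNIV F \<and> (F \<longlongrightarrow> 0) at_bot \<and> (F \<longlongrightarrow> 1) at_top"

text \<open>The \<open>n\<close>-th row of the triangular array. Measurability of the vectors
  \<open>(X i, Y i)\<close> is part of \<open>indep_vars\<close>. That the copula of \<open>(X i, Y i)\<close> is the normal
  copula with parameter \<open>\<rho> i\<close> is expressed through the density of \<open>(F1 (X i), F2 (Y i))\<close>.\<close>
definition normal_copula_row ::
  "'a measure \<Rightarrow> (real \<Rightarrow> real) \<Rightarrow> (real \<Rightarrow> real) \<Rightarrow> nat \<Rightarrow> (nat \<Rightarrow> real) \<Rightarrow>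
   (nat \<Rightarrow> 'a \<Rightarrow> real) \<Rightarrow> (nat \<Rightarrow> 'a \<Rightarrow> real) \<Rightarrow> bool" where
  "normal_copula_row M F1 F2 n \<rho> X Y \<longleftrightarrow>
     prob_space M \<and>
     prob_space.indep_vars M (\<lambda>_. borel :: (real \<times> real) measure)
       (\<lambda>i \<omega>. (X i \<omega>, Y i \<omega>)) {1..n} \<and>
     (\<forall>i\<in>{1..n}.
        cdf (distr M borel (X i)) = F1 \<and>
        cdf (distr M borel (Y i)) = F2 \<and>
        -1 < \<rho> i \<and> \<rho> i < 1 \<and>
        distributed M lborel (\<lambda>\<omega>. (F1 (X i \<omega>), F2 (Y i \<omega>)))
          (\<lambda>p. ennreal (normal_copula_density (\<rho> i) p)))"

definition normalized_maxima_cdf ::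
  "'a measure \<Rightarrow> (real \<Rightarrow> real) \<Rightarrow> (real \<Rightarrow> real) \<Rightarrow> nat \<Rightarrow>
   (nat \<Rightarrow> 'a \<Rightarrow> real) \<Rightarrow> (nat \<Rightarrow> 'a \<Rightarrow> real) \<Rightarrow> real \<Rightarrow> real \<Rightarrow> real" where
  "normalized_maxima_cdf M F1 F2 n X Y x y =
     \<P>(\<omega> in M. real n * ((MAX i\<in>{1..n}. F1 (X i \<omega>)) - 1) \<le> x \<and>
                real n * ((MAX i\<in>{1..n}. F2 (Y i \<omega>)) - 1) \<le> y)"

end

theory Submission
  imports Defs "HOL-Real_Asymp.Real_Asymp"
begin

text \<open>
  Write \<open>Q = 1 - \<Phi>\<close> for the standard normal tail, \<open>\<phi>\<close> for the density, and choose \<open>p\<close>, \<open>q\<close>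
  (depending on \<open>n\<close>) with \<open>Q p = - x / n\<close> and \<open>Q q = - y / n\<close>. Both \<open>F1 (X i)\<close> and \<open>F2 (Y i)\<close> are
  uniform, so inclusion and exclusion over the two exceedance events give, for one vector,
  the probability \<open>1 + (x + y) / n + J\<close>, where \<open>J = J \<rho> p q\<close> is the joint tail: the probability that
  standard normal variables with correlation \<open>\<rho>\<close> exceed \<open>p\<close> and \<open>q\<close>. By independence the
  distribution function of the maxima is a product of such factors
  (\<open>normalized_maxima_cdf_eq_prod\<close>), hence \<open>exp (x + y + A + O(1 / n))\<close>, where \<open>A\<close> is the average
  of the numbers \<open>n J\<close> over the row, and its difference to \<open>exp (x + y)\<close> is asymptotically
  \<open>A exp (x + y)\<close> (\<open>triangular_product_limit\<close>). What remains is to show that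
  \<open>n J\<close> behaves like \<open>sqrt (2 / pi) sqrt (x y)\<close> times the weight \<open>exp (- m / 2) / sqrt m\<close> when
  \<open>\<rho> = 1 - m / ln n\<close> (\<open>joint_tail_limit\<close>).

  Given that the first variable is \<open>a\<close>, the second is normal with mean \<open>\<rho> a\<close> and variance
  \<open>\<sigma>\<^sup>2 = 1 - \<rho>\<^sup>2\<close>. Integrating over \<open>a = p + w / p\<close> with \<open>w > 0\<close>,
  \<open>J = \<phi> p / p * \<integral> exp (- w - w\<^sup>2 / (2 p\<^sup>2)) Q (c - d w) dw\<close> with \<open>c = (q - \<rho> p) / \<sigma>\<close> and
  \<open>d = \<rho> / (p \<sigma>)\<close>. The Mills ratio \<open>Q t \<sim> \<phi> t / t\<close> yields \<open>n \<phi> p / p \<rightarrow> - x\<close>, and also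
  \<open>p\<^sup>2 / 2 + ln p = ln n + O(1)\<close> and \<open>p (q - p) \<rightarrow> ln (x / y)\<close>. From these one computes
  \<open>c\<^sup>2 - m \<rightarrow> ln (x / y)\<close> and \<open>c d \<rightarrow> 1 / 2\<close> (\<open>correlation_scaling_limits\<close>). As \<open>c\<close> tends to infinity, another
  use of the Mills ratio shows that \<open>Q (c - d w)\<close> is close to
  \<open>exp (- c\<^sup>2 / 2 + w / 2) / (c sqrt (2 pi))\<close>. By dominated convergence the integral is then close to
  \<open>2 exp (- c\<^sup>2 / 2) / (c sqrt (2 pi))\<close> (\<open>excess_integral_normal_tail_limit\<close>), and
  \<open>exp (- c\<^sup>2 / 2)\<close> is close to \<open>exp (- m / 2) sqrt (y / x)\<close>.

  The growth condition \<open>m = o(ln ln n)\<close> serves twice: it makes \<open>m (p\<^sup>2 / (2 ln n) - 1)\<close> and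
  \<open>m\<^sup>2 / ln n\<close> vanish, and it keeps every weight above \<open>1 / ln n\<close>, so that the \<open>O(1 / n)\<close> error of the
  product is negligible. Uniformity within a row comes for free, because the limit of
  \<open>n J\<close> over the weight is proved along an arbitrary choice of one index per row
  (\<open>uniform_over_rows\<close>).
\<close>

section \<open>The standard normal distribution\<close>

definition normal_tail :: "real \<Rightarrow> real" where
  "normal_tail t = measure std_normal_distribution {t<..}"

lemma normal_tail_nonneg: "0 \<le> normal_tail t"
  by (simp add: normal_tail_def)

lemma normal_tail_le_1: "normal_tail t \<le> 1"
proof -
  interpret real_distribution std_normal_distribution by (rule real_dist_normal_dist)
  show ?thesis by (simp add: normal_tail_def)
qed

lemma normal_tail_antimono: "s \<le> t \<Longrightarrow> normal_tail t \<le> normal_tail s"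
proof -
  interpret real_distribution std_normal_distribution by (rule real_dist_normal_dist)
  show "s \<le> t \<Longrightarrow> normal_tail t \<le> normal_tail s"
    unfolding normal_tail_def by (intro finite_measure_mono) auto
qed

lemma borel_measurable_normal_tail [measurable]: "normal_tail \<in> borel_measurable borel"
proof -
  have "(\<lambda>t. - normal_tail t) \<in> borel_measurable borel"
    by (intro borel_measurable_mono monoI) (simp add: normal_tail_antimono)
  from borel_measurable_uminus[OF this] show ?thesis by simp
qed

lemma normal_tail_eq_cdf: "normal_tail t = 1 - std_normal_cdf t"
proof -
  interpret real_distribution std_normal_distribution by (rule real_dist_normal_dist)
  have "{t<..} = UNIV - {..t}" by auto
  then show ?thesis
    using prob_compl[of "{..t}"] by (simp add: normal_tail_def std_normal_cdf_def cdf_def)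
qed

text \<open>Tails are manipulated as nonnegative integrals below, where substitution and Tonelli need no
  integrability.\<close>
lemma normal_tail_nn_integral:
  "ennreal (normal_tail t) = (\<integral>\<^sup>+a. ennreal (indicator {t<..} a * std_normal_density a) \<partial>lborel)"
proof -
  interpret real_distribution std_normal_distribution by (rule real_dist_normal_dist)
  have "ennreal (normal_tail t) = emeasure std_normal_distribution {t<..}"
    by (simp add: normal_tail_def emeasure_eq_measure)
  also have "\<dots> = (\<integral>\<^sup>+a. ennreal (indicator {t<..} a * std_normal_density a) \<partial>lborel)"
    by (subst emeasure_density) (auto intro!: nn_integral_cong split: split_indicator)
  finally show ?thesis .
qed

lemma std_normal_cdf_strict_mono: "strict_mono std_normal_cdf"
proof (rule strict_monoI)
  interpret real_distribution std_normal_distribution by (rule real_dist_normal_dist)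
  fix a b :: real assume "a < b"
  have "emeasure std_normal_distribution {a<..b} \<noteq> 0"
  proof
    assume "emeasure std_normal_distribution {a<..b} = 0"
    then have "(\<integral>\<^sup>+x. ennreal (std_normal_density x) * indicator {a<..b} x \<partial>lborel) = 0"
      by (simp add: emeasure_density)
    then have "AE x in lborel. ennreal (std_normal_density x) * indicator {a<..b} x = 0"
      by (subst (asm) nn_integral_0_iff_AE) auto
    then have "AE x in lborel. x \<notin> {a<..b}"
    proof (rule eventually_mono)
      fix x assume "ennreal (std_normal_density x) * indicator {a<..b} x = 0"
      then show "x \<notin> {a<..b}"
        using normal_density_pos[of 1 0 x] by (auto simp: indicator_def)
    qed
    then have "emeasure lborel {a<..b} = 0"
      by (subst (asm) AE_iff_measurable[of "{a<..b}"]) auto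
    with \<open>a < b\<close> show False by simp
  qed
  then have "0 < measure std_normal_distribution {a<..b}"
    by (simp add: emeasure_eq_measure zero_less_measure_iff)
  with cdf_diff_eq[OF \<open>a < b\<close>] show "std_normal_cdf a < std_normal_cdf b"
    by (simp add: std_normal_cdf_def)
qed

lemma continuous_distribution_function_std_normal_cdf:
  "continuous_distribution_function std_normal_cdf"
proof -
  interpret real_distribution std_normal_distribution by (rule real_dist_normal_dist)
  have "measure std_normal_distribution {a} = 0" for a
    by (simp add: measure_def emeasure_density nn_integral_0_iff_AE
        AE_lborel_singleton[of a, THEN eventually_mono])
  then have "isCont std_normal_cdf a" for a
    by (simp add: isCont_cdf std_normal_cdf_def)
  then show ?thesis
    unfolding continuous_distribution_function_def
    using strict_mono_mono[OF std_normal_cdf_strict_mono] cdf_lim_at_bot cdf_lim_at_top_prob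
    by (simp add: std_normal_cdf_def continuous_at_imp_continuous_on)
qed

lemma borel_measurable_std_normal_cdf [measurable]: "std_normal_cdf \<in> borel_measurable borel"
  using continuous_distribution_function_std_normal_cdf
  by (auto intro!: borel_measurable_continuous_onI simp: continuous_distribution_function_def)

lemma std_normal_cdf_bounds: "0 < std_normal_cdf a" "std_normal_cdf a < 1"
proof -
  interpret N: real_distribution std_normal_distribution by (rule real_dist_normal_dist)
  show "0 < std_normal_cdf a" "std_normal_cdf a < 1"
    using strict_monoD[OF std_normal_cdf_strict_mono, of "a - 1" a]
      strict_monoD[OF std_normal_cdf_strict_mono, of a "a + 1"]
      N.cdf_nonneg[of "a - 1"] N.cdf_bounded_prob[of "a + 1"]
    by (auto simp: std_normal_cdf_def)
qed

lemma std_normal_quantile_cdf: "std_normal_quantile (std_normal_cdf a) = a"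
  unfolding std_normal_quantile_def
  by (intro inv_f_f strict_mono_imp_inj_on std_normal_cdf_strict_mono)

lemma normal_tail_pos: "0 < normal_tail t"
  using std_normal_cdf_bounds(2)[of t] by (simp add: normal_tail_eq_cdf)

lemma continuous_distribution_function_surj:
  assumes F: "continuous_distribution_function F" and u: "0 < u" "u < 1"
  obtains a where "F a = u"
proof -
  have "\<forall>\<^sub>F x in at_bot. F x < u" "\<forall>\<^sub>F x in at_top. u < F x"
    using F u by (auto simp: continuous_distribution_function_def order_tendsto_iff)
  then obtain l r where l: "F l < u" and r: "u < F r"
    by (meson eventually_happens' trivial_limit_at_bot_linorder trivial_limit_at_top_linorder)
  have "l \<le> r"
    using F l r monoD[of F r l] by (force simp: continuous_distribution_function_def)
  moreover have "\<forall>x. l \<le> x \<and> x \<le> r \<longrightarrow> isCont F x"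
    using F by (auto simp: continuous_distribution_function_def continuous_on_eq_continuous_at)
  ultimately show ?thesis
    using IVT[of F l u r] l r that by force
qed

lemma normal_tail_quantile:
  assumes "0 < s" "s < 1"
  shows "normal_tail (std_normal_quantile (1 - s)) = s"
proof -
  obtain a where "std_normal_cdf a = 1 - s"
    using continuous_distribution_function_surj[OF continuous_distribution_function_std_normal_cdf, of "1 - s"]
      assms by auto
  then have "std_normal_cdf (std_normal_quantile (1 - s)) = 1 - s"
    by (metis std_normal_quantile_cdf)
  then show ?thesis by (simp add: normal_tail_eq_cdf)
qed

text \<open>The sublevel set is closed, downward closed, nonempty and bounded above, so it is the half line
  below its supremum. Strict monotonicity is not available: \<open>F\<close> may be constant on intervals.\<close>
lemma sublevel_continuous_distribution_function:
  assumes F: "continuous_distribution_function F" and u: "0 < u" "u < 1"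
  obtains a where "{x. F x \<le> u} = {..a}" "F a = u"
proof -
  let ?S = "{x. F x \<le> u}"
  from continuous_distribution_function_surj[OF assms] obtain b where b: "F b = u" .
  have "\<forall>\<^sub>F x in at_top. u < F x"
    using F u by (auto simp: continuous_distribution_function_def order_tendsto_iff)
  then obtain r where r: "u < F r"
    by (meson eventually_happens' trivial_limit_at_top_linorder)
  have mono: "mono F" using F by (simp add: continuous_distribution_function_def)
  have bdd: "bdd_above ?S"
  proof (rule bdd_aboveI[of _ r])
    fix x assume "x \<in> ?S"
    with r show "x \<le> r" using monoD[OF mono, of r x] by (cases "x \<le> r") auto
  qed
  have "closed ?S"
    using F by (intro closed_Collect_le)
      (auto simp: continuous_distribution_function_def)
  then have mem: "Sup ?S \<in> ?S"
    using b bdd by (intro closed_contains_Sup) auto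
  have "?S = {..Sup ?S}"
  proof (intro set_eqI iffI)
    fix x assume "x \<in> ?S" then show "x \<in> {..Sup ?S}" by (metis atMost_iff bdd cSup_upper)
  next
    fix x assume "x \<in> {..Sup ?S}"
    then show "x \<in> ?S" using mem monoD[OF mono, of x "Sup ?S"] by auto
  qed
  moreover have "F (Sup ?S) = u"
    using mem b monoD[OF mono, of b "Sup ?S"] cSup_upper[OF _ bdd, of b] by auto
  ultimately show ?thesis using that by blast
qed

lemma probability_integral_transform:
  assumes F: "continuous_distribution_function F" and "cdf M = F" and "0 < u" "u < 1"
  shows "measure M {x. F x \<le> u} = u"
  using sublevel_continuous_distribution_function[OF F assms(3,4)] assms(2)
  by (metis cdf_def)

text \<open>By the probability integral transform both sides have the same distribution function. This
  replaces the change of variables \<open>u = \<Phi> a\<close>, so no derivative of \<open>\<Phi>\<close> has to be computed.\<close>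
lemma distr_std_normal_cdf:
  "distr std_normal_distribution borel std_normal_cdf = density lborel (indicator {0<..<1})"
proof (rule cdf_unique)
  note F = continuous_distribution_function_std_normal_cdf
  interpret N: real_distribution std_normal_distribution by (rule real_dist_normal_dist)
  show D: "real_distribution (distr std_normal_distribution borel std_normal_cdf)"
    by (auto simp: real_distribution_def real_distribution_axioms_def intro!: N.prob_space_distr)
  show U: "real_distribution (density lborel (indicator {0<..<1::real}))"
    by (auto simp: real_distribution_def real_distribution_axioms_def emeasure_density
        intro!: prob_spaceI)
  interpret D: real_distribution "distr std_normal_distribution borel std_normal_cdf" by fact
  interpret U: real_distribution "density lborel (indicator {0<..<1::real})" by fact
  show "cdf (distr std_normal_distribution borel std_normal_cdf)
      = cdf (density lborel (indicator {0<..<1}))"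
  proof
    fix u :: real
    have l: "cdf (distr std_normal_distribution borel std_normal_cdf) u
       = measure std_normal_distribution {x. std_normal_cdf x \<le> u}"
      by (simp add: cdf_def measure_distr vimage_def)
    have r: "cdf (density lborel (indicator {0<..<1})) u = measure lborel ({0<..<1} \<inter> {..u})"
      by (simp add: cdf_def measure_def emeasure_density flip: indicator_inter_arith)
    consider "u \<le> 0" | "0 < u" "u < 1" | "1 \<le> u" by linarith
    then show "cdf (distr std_normal_distribution borel std_normal_cdf) u
      = cdf (density lborel (indicator {0<..<1})) u"
    proof cases
      case 1
      then have "{x. std_normal_cdf x \<le> u} = {}" "{0<..<1} \<inter> {..u} = {}"
        using std_normal_cdf_bounds(1) by (auto simp: not_le intro: order.strict_trans1)
      then show ?thesis unfolding l r by simp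
    next
      case 2
      then have "{0<..<1} \<inter> {..u} = {0<..u}" by auto
      with 2 show ?thesis
        unfolding l r using probability_integral_transform[OF F _ 2, of std_normal_distribution]
        by (simp add: std_normal_cdf_def)
    next
      case 3
      then have "{x. std_normal_cdf x \<le> u} = UNIV" "{0<..<1} \<inter> {..u} = {0<..<1}"
        using std_normal_cdf_bounds(2) by (auto intro: less_imp_le order.strict_trans2)
      then show ?thesis unfolding l r using N.prob_space by simp
    qed
  qed
qed

lemma nn_integral_unit_interval_std_normal_cdf:
  assumes [measurable]: "g \<in> borel_measurable borel"
  shows "(\<integral>\<^sup>+u. indicator {0<..<1} u * g u \<partial>lborel)
       = (\<integral>\<^sup>+a. ennreal (std_normal_density a) * g (std_normal_cdf a) \<partial>lborel)"
proof -
  have "(\<integral>\<^sup>+u. indicator {0<..<1} u * g u \<partial>lborel)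
      = (\<integral>\<^sup>+u. g u \<partial>density lborel (indicator {0<..<1}))"
    by (simp add: nn_integral_density)
  also have "\<dots> = (\<integral>\<^sup>+a. g (std_normal_cdf a) \<partial>std_normal_distribution)"
    by (simp add: distr_std_normal_cdf[symmetric] nn_integral_distr)
  finally show ?thesis by (simp add: nn_integral_density)
qed

section \<open>Excess integrals and the Mills ratio\<close>

text \<open>Up to the factor \<open>\<phi> p / p\<close> this is the expectation of \<open>g (p (Z - p))\<close> over \<open>Z > p\<close> for a standard
  normal \<open>Z\<close>: the excess of \<open>Z\<close> over a high level \<open>p\<close>, magnified by \<open>p\<close>, is nearly exponential.\<close>
definition excess_integral :: "real \<Rightarrow> (real \<Rightarrow> real) \<Rightarrow> real" where
  "excess_integral p g = (LINT w|lborel. indicator {0<..} w * exp (- w - w\<^sup>2 / (2 * p\<^sup>2)) * g w)"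

lemma has_bochner_integral_exp_half_line:
  assumes "0 < (a :: real)"
  shows "has_bochner_integral lborel (\<lambda>w. indicator {0<..} w * exp (- (a * w))) (1 / a)"
proof (rule has_bochner_integral_nn_integral)
  have "(\<integral>\<^sup>+w. ennreal (indicator {0<..} w * exp (- (a * w))) \<partial>lborel)
      = (\<integral>\<^sup>+w. ennreal (exp (- (a * w))) * indicator {0..} w \<partial>lborel)"
    by (intro nn_integral_cong_AE AE_I[of _ _ "{0}"]) (auto simp: indicator_def)
  also have "\<dots> = ennreal (0 - (- exp (- (a * 0)) / a))"
  proof (intro nn_integral_FTC_atLeast)
    show "((\<lambda>b. - exp (- (a * b)) / a) \<longlongrightarrow> 0) at_top"
      using assms by real_asymp
  qed (use assms in \<open>auto intro!: derivative_eq_intros\<close>)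
  finally show "(\<integral>\<^sup>+w. ennreal (indicator {0<..} w * exp (- (a * w))) \<partial>lborel) = ennreal (1 / a)"
    by simp
qed (use assms in auto)

lemma integrable_excess:
  fixes g :: "real \<Rightarrow> real"
  assumes [measurable]: "g \<in> borel_measurable borel" and g: "\<And>w. 0 \<le> g w" "\<And>w. g w \<le> 1"
  shows "integrable lborel (\<lambda>w. indicator {0<..} w * exp (- w - w\<^sup>2 / (2 * p\<^sup>2)) * g w)"
proof (rule Bochner_Integration.integrable_bound)
  show "integrable lborel (\<lambda>w. indicator {0<..} w * exp (- (1 * w)) :: real)"
    using has_bochner_integral_exp_half_line[of 1] by (simp add: has_bochner_integral_iff)
  have "exp (- w - w\<^sup>2 / (2 * p\<^sup>2)) * g w \<le> exp (- w) * 1" for w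
    using g by (intro mult_mono) auto
  then show "AE w in lborel. norm (indicator {0<..} w * exp (- w - w\<^sup>2 / (2 * p\<^sup>2)) * g w)
      \<le> norm (indicator {0<..} w * exp (- (1 * w)) :: real)"
    using g by (intro always_eventually allI) (auto simp: indicator_def)
qed auto

text \<open>Substitute \<open>a = p + w / p\<close> and use \<open>\<phi> (p + w / p) = \<phi> p exp (- w - w\<^sup>2 / (2 p\<^sup>2))\<close>.\<close>
lemma normal_tail_integral_eq_excess_integral:
  assumes p: "0 < p" and [measurable]: "g \<in> borel_measurable borel"
    and g: "\<And>w. 0 \<le> g w" "\<And>w. g w \<le> 1"
  shows "(\<integral>\<^sup>+a. ennreal (indicator {p<..} a * std_normal_density a * g (p * (a - p))) \<partial>lborel)
       = ennreal (std_normal_density p / p * excess_integral p g)"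
proof -
  have dens: "std_normal_density (p + w / p)
      = std_normal_density p * exp (- w - w\<^sup>2 / (2 * p\<^sup>2))" for w
  proof -
    have "- (p + w / p)\<^sup>2 / 2 = - p\<^sup>2 / 2 + (- w - w\<^sup>2 / (2 * p\<^sup>2))"
      using p by (simp add: field_simps power2_eq_square)
    then show ?thesis by (simp only: std_normal_density_def exp_add mult.assoc)
  qed
  have "(\<integral>\<^sup>+a. ennreal (indicator {p<..} a * std_normal_density a * g (p * (a - p))) \<partial>lborel)
    = ennreal (1 / p) * (\<integral>\<^sup>+w. ennreal (indicator {p<..} (p + (1 / p) * w)
       * std_normal_density (p + (1 / p) * w) * g (p * (p + (1 / p) * w - p))) \<partial>lborel)"
    using p by (subst nn_integral_real_affine[where c="1 / p" and t=p]) auto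
  also have "\<dots> = ennreal (1 / p) * (\<integral>\<^sup>+w. ennreal (std_normal_density p) *
      ennreal (indicator {0<..} w * exp (- w - w\<^sup>2 / (2 * p\<^sup>2)) * g w) \<partial>lborel)"
    using p g by (intro arg_cong2[where f="(*)"] refl nn_integral_cong)
      (auto simp: indicator_def dens ennreal_mult[symmetric] zero_less_divide_iff mult_ac)
  also have "\<dots> = ennreal (1 / p) * (ennreal (std_normal_density p) * ennreal (excess_integral p g))"
    unfolding excess_integral_def using g
    by (subst nn_integral_cmult, simp)
       (subst nn_integral_eq_integral[OF integrable_excess], auto)
  also have "\<dots> = ennreal (std_normal_density p / p * excess_integral p g)"
    using p by (simp add: ennreal_mult'[symmetric] ennreal_mult''[symmetric])
  finally show ?thesis .
qed

text \<open>For \<open>p\<close> tending to infinity the Gaussian correction disappears and the exponential law remains;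
  \<open>b < 1\<close> makes \<open>exp (b w)\<close> integrable against it. A bound for all large \<open>n\<close> suffices.\<close>
lemma excess_integral_dominated_convergence:
  fixes p :: "nat \<Rightarrow> real"
  assumes [measurable]: "\<And>n. g n \<in> borel_measurable borel" "h \<in> borel_measurable borel"
    and p: "filterlim p at_top sequentially"
    and lim: "\<And>w. 0 < w \<Longrightarrow> (\<lambda>n. g n w) \<longlonglongrightarrow> h w"
    and bound: "\<forall>\<^sub>F n in sequentially. \<forall>w>0. \<bar>g n w\<bar> \<le> exp (b * w)" and b: "b < 1"
  shows "(\<lambda>n. excess_integral (p n) (g n)) \<longlonglongrightarrow> (LINT w|lborel. indicator {0<..} w * exp (- w) * h w)"
proof -
  from bound obtain N where N: "\<And>n w. N \<le> n \<Longrightarrow> 0 < w \<Longrightarrow> \<bar>g n w\<bar> \<le> exp (b * w)"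
    by (auto simp: eventually_sequentially)
  have "(\<lambda>n. excess_integral (p (n + N)) (g (n + N))) \<longlonglongrightarrow> (LINT w|lborel. indicator {0<..} w * exp (- w) * h w)"
    unfolding excess_integral_def
  proof (rule integral_dominated_convergence)
    show "integrable lborel (\<lambda>w. indicator {0<..} w * exp (- ((1 - b) * w)) :: real)"
      using has_bochner_integral_exp_half_line[of "1 - b"] b by (simp add: has_bochner_integral_iff)
    show "AE w in lborel. (\<lambda>n. indicator {0<..} w * exp (- w - w\<^sup>2 / (2 * (p (n + N))\<^sup>2)) * g (n + N) w)
        \<longlonglongrightarrow> indicator {0<..} w * exp (- w) * h w"
    proof (intro always_eventually allI)
      fix w :: real
      show "(\<lambda>n. indicator {0<..} w * exp (- w - w\<^sup>2 / (2 * (p (n + N))\<^sup>2)) * g (n + N) w)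
        \<longlonglongrightarrow> indicator {0<..} w * exp (- w) * h w"
      proof (cases "0 < w")
        case True
        have "filterlim (\<lambda>n. 2 * (p n)\<^sup>2) at_top sequentially"
          using p by (intro filterlim_tendsto_pos_mult_at_top[OF tendsto_const] filterlim_pow_at_top) auto
        then have "(\<lambda>n. w\<^sup>2 / (2 * (p n)\<^sup>2)) \<longlonglongrightarrow> 0"
          by (intro tendsto_divide_0[OF tendsto_const] filterlim_at_top_imp_at_infinity)
        then have "(\<lambda>n. indicator {0<..} w * exp (- w - w\<^sup>2 / (2 * (p n)\<^sup>2)) * g n w)
            \<longlonglongrightarrow> indicator {0<..} w * exp (- w - 0) * h w"
          using lim[OF True] by (intro tendsto_intros)
        then show ?thesis
          using LIMSEQ_ignore_initial_segment by fastforce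
      qed simp
    qed
    fix n
    show "AE w in lborel. norm (indicator {0<..} w * exp (- w - w\<^sup>2 / (2 * (p (n + N))\<^sup>2)) * g (n + N) w)
        \<le> indicator {0<..} w * exp (- ((1 - b) * w))"
    proof (intro always_eventually allI)
      fix w :: real
      show "norm (indicator {0<..} w * exp (- w - w\<^sup>2 / (2 * (p (n + N))\<^sup>2)) * g (n + N) w)
        \<le> indicator {0<..} w * exp (- ((1 - b) * w))"
      proof (cases "0 < w")
        case True
        have "exp (- w - w\<^sup>2 / (2 * (p (n + N))\<^sup>2)) * \<bar>g (n + N) w\<bar> \<le> exp (- w) * exp (b * w)"
          using N[of "n + N" w] True by (intro mult_mono) auto
        also have "\<dots> = exp (- ((1 - b) * w))"
          by (simp add: mult_exp_exp algebra_simps)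
        finally show ?thesis using True by (simp add: abs_mult)
      qed simp
    qed
  qed measurable
  then show ?thesis by (rule LIMSEQ_offset)
qed

text \<open>The constant integrand \<open>1\<close> turns the excess integral into the Mills ratio, whose upper bound and
  limit are then immediate.\<close>
lemma normal_tail_eq_excess_integral:
  assumes "0 < t"
  shows "normal_tail t = std_normal_density t / t * excess_integral t (\<lambda>_. 1)"
proof -
  have "0 \<le> excess_integral t (\<lambda>_. 1)"
    unfolding excess_integral_def by (intro integral_nonneg_AE) auto
  with normal_tail_integral_eq_excess_integral[OF assms, of "\<lambda>_. 1"] assms
  show ?thesis
    by (simp add: normal_tail_nn_integral[symmetric] normal_tail_nonneg)
qed

lemma normal_tail_le:
  assumes "0 < t"
  shows "normal_tail t \<le> std_normal_density t / t"
proof -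
  have "excess_integral t (\<lambda>_. 1) \<le> (LINT w|lborel. indicator {0<..} w * exp (- (1 * w)))"
    unfolding excess_integral_def
  proof (rule integral_mono)
    show "integrable lborel (\<lambda>w. indicator {0<..} w * exp (- (1 * w)) :: real)"
      using has_bochner_integral_exp_half_line[of 1] by (simp add: has_bochner_integral_iff)
  qed (use integrable_excess[of "\<lambda>_. 1"] in \<open>auto simp: indicator_def\<close>)
  also have "\<dots> = 1"
    using has_bochner_integral_exp_half_line[of 1] by (simp add: has_bochner_integral_iff)
  finally have "excess_integral t (\<lambda>_. 1) \<le> 1" .
  then show ?thesis
    unfolding normal_tail_eq_excess_integral[OF assms]
    using assms by (intro mult_left_le) auto
qed

lemma mills_ratio_limit:
  fixes t :: "nat \<Rightarrow> real"
  assumes t: "filterlim t at_top sequentially"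
  shows "(\<lambda>n. t n * exp ((t n)\<^sup>2 / 2) * normal_tail (t n)) \<longlonglongrightarrow> 1 / sqrt (2 * pi)"
proof -
  have "(\<lambda>n. excess_integral (t n) (\<lambda>_. 1)) \<longlonglongrightarrow> (LINT w|lborel. indicator {0<..} w * exp (- w) * 1)"
    by (rule excess_integral_dominated_convergence[OF _ _ t, where b = 0]) auto
  moreover have "(LINT w|lborel. indicator {0<..} w * exp (- w) * 1) = (1 :: real)"
    using has_bochner_integral_exp_half_line[of 1] by (simp add: has_bochner_integral_iff)
  ultimately have "(\<lambda>n. 1 / sqrt (2 * pi) * excess_integral (t n) (\<lambda>_. 1)) \<longlonglongrightarrow> 1 / sqrt (2 * pi) * 1"
    by (intro tendsto_intros) simp
  moreover have "\<forall>\<^sub>F n in sequentially. 1 / sqrt (2 * pi) * excess_integral (t n) (\<lambda>_. 1)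
      = t n * exp ((t n)\<^sup>2 / 2) * normal_tail (t n)"
    using eventually_compose_filterlim[OF eventually_gt_at_top[of 0] t]
  proof eventually_elim
    case (elim n)
    have "exp ((t n)\<^sup>2 / 2) * exp (- (t n)\<^sup>2 / 2) = 1" by (simp add: mult_exp_exp)
    with elim show ?case
      by (simp add: normal_tail_eq_excess_integral std_normal_density_def field_simps)
  qed
  ultimately show ?thesis by (auto intro: Lim_transform_eventually)
qed

section \<open>The joint tail of the normal copula\<close>

lemma normal_density_tail_nn_integral:
  assumes "0 < \<sigma>"
  shows "(\<integral>\<^sup>+b. ennreal (indicator {q<..} b * normal_density \<mu> \<sigma> b) \<partial>lborel)
       = ennreal (normal_tail ((q - \<mu>) / \<sigma>))"
proof -
  have scale: "\<sigma> * normal_density \<mu> \<sigma> (\<mu> + \<sigma> * v) = std_normal_density v" for v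
    using assms by (simp add: normal_density_def real_sqrt_mult power_mult_distrib)
  have ind: "indicator {q<..} (\<mu> + \<sigma> * v) = (indicator {(q - \<mu>) / \<sigma><..} v :: real)" for v
    using assms by (auto simp: indicator_def pos_divide_less_eq algebra_simps)
  have "(\<integral>\<^sup>+b. ennreal (indicator {q<..} b * normal_density \<mu> \<sigma> b) \<partial>lborel)
      = ennreal \<sigma> *
        (\<integral>\<^sup>+v. ennreal (indicator {q<..} (\<mu> + \<sigma> * v) * normal_density \<mu> \<sigma> (\<mu> + \<sigma> * v)) \<partial>lborel)"
    using assms by (subst nn_integral_real_affine[where c=\<sigma> and t=\<mu>]) auto
  also have "\<dots> = (\<integral>\<^sup>+v. ennreal (indicator {(q - \<mu>) / \<sigma><..} v * std_normal_density v) \<partial>lborel)"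
    using assms
    by (subst nn_integral_cmult[symmetric])
      (auto intro!: nn_integral_cong simp: ind scale[symmetric] ennreal_mult[symmetric] mult.left_commute mult.assoc)
  finally show ?thesis by (simp add: normal_tail_nn_integral)
qed

text \<open>In Gaussian coordinates the copula density becomes a conditional density: given that the first
  normal variable is \<open>a\<close>, the second has mean \<open>\<rho> a\<close> and variance \<open>1 - \<rho>\<^sup>2\<close>.\<close>
lemma normal_copula_density_std_normal_cdf:
  assumes "-1 < \<rho>" "\<rho> < 1"
  shows "std_normal_density b * normal_copula_density \<rho> (std_normal_cdf a, std_normal_cdf b)
       = normal_density (\<rho> * a) (sqrt (1 - \<rho>\<^sup>2)) b"
proof -
  from assms have s: "0 < 1 - \<rho>\<^sup>2"
    by (simp add: abs_square_less_1)
  have e: "- b\<^sup>2 / 2 + (2 * \<rho> * a * b - \<rho>\<^sup>2 * a\<^sup>2 - \<rho>\<^sup>2 * b\<^sup>2) / (2 * (1 - \<rho>\<^sup>2))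
       = - (b - \<rho> * a)\<^sup>2 / (2 * (1 - \<rho>\<^sup>2))"
    using s by (simp add: field_simps power2_eq_square)
  have "std_normal_density b * normal_copula_density \<rho> (std_normal_cdf a, std_normal_cdf b)
     = 1 / sqrt (2 * pi * (1 - \<rho>\<^sup>2)) *
       (exp (- b\<^sup>2 / 2) * exp ((2 * \<rho> * a * b - \<rho>\<^sup>2 * a\<^sup>2 - \<rho>\<^sup>2 * b\<^sup>2) / (2 * (1 - \<rho>\<^sup>2))))"
    by (simp add: normal_copula_density_def std_normal_cdf_bounds std_normal_quantile_cdf
        std_normal_density_def real_sqrt_mult)
  also have "\<dots> = normal_density (\<rho> * a) (sqrt (1 - \<rho>\<^sup>2)) b"
    unfolding exp_add[symmetric] e using s by (simp add: normal_density_def)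
  finally show ?thesis .
qed

text \<open>Condition on the first coordinate: Tonelli, followed by a passage to Gaussian coordinates in each
  variable, leaves a normal tail as the inner integral.\<close>
lemma normal_copula_joint_tail:
  assumes D: "distributed M lborel (\<lambda>\<omega>. (U \<omega>, V \<omega>)) (\<lambda>p. ennreal (normal_copula_density \<rho> p))"
    and \<rho>: "-1 < \<rho>" "\<rho> < 1"
  shows "emeasure M {\<omega> \<in> space M. std_normal_cdf p < U \<omega> \<and> std_normal_cdf q < V \<omega>}
    = (\<integral>\<^sup>+a. ennreal (indicator {p<..} a * std_normal_density a
                     * normal_tail ((q - \<rho> * a) / sqrt (1 - \<rho>\<^sup>2))) \<partial>lborel)"
proof -
  let ?c = "\<lambda>z. ennreal (normal_copula_density \<rho> z)"
  have [measurable]: "?c \<in> borel_measurable borel"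
    using distributed_borel_measurable[OF D] by simp
  have [measurable]: "?c \<in> borel_measurable (borel \<Otimes>\<^sub>M borel)"
    using distributed_borel_measurable[OF D] by (simp add: borel_prod)
  from \<rho> have s: "0 < sqrt (1 - \<rho>\<^sup>2)" by (simp add: abs_square_less_1)
  \<comment> \<open>The indicator of the unit interval, on which the density lives, is inserted so that both
    integrals can be pulled back along \<open>\<Phi>\<close>.\<close>
  define H where "H u = (\<integral>\<^sup>+v. indicator {0<..<1} v *
      (?c (u, v) * indicator {std_normal_cdf p<..} u * indicator {std_normal_cdf q<..} v) \<partial>lborel)" for u
  have [measurable]: "H \<in> borel_measurable borel"
    unfolding H_def by measurable
  have cdf_less: "std_normal_cdf x < std_normal_cdf y \<longleftrightarrow> x < y" for x y
    by (simp add: strict_mono_less[OF std_normal_cdf_strict_mono])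
  have H: "ennreal (std_normal_density a) * H (std_normal_cdf a)
      = ennreal (indicator {p<..} a * std_normal_density a * normal_tail ((q - \<rho> * a) / sqrt (1 - \<rho>\<^sup>2)))" for a
  proof -
    have "H (std_normal_cdf a)
      = (\<integral>\<^sup>+b. ennreal (std_normal_density b) * (?c (std_normal_cdf a, std_normal_cdf b) *
           indicator {std_normal_cdf p<..} (std_normal_cdf a) *
           indicator {std_normal_cdf q<..} (std_normal_cdf b)) \<partial>lborel)"
      unfolding H_def by (rule nn_integral_unit_interval_std_normal_cdf) measurable
    also have "\<dots> = (\<integral>\<^sup>+b. indicator {p<..} a * ennreal (indicator {q<..} b *
        normal_density (\<rho> * a) (sqrt (1 - \<rho>\<^sup>2)) b) \<partial>lborel)"
      using normal_copula_density_std_normal_cdf[OF \<rho>, symmetric]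
      by (intro nn_integral_cong) (auto simp: indicator_def cdf_less ennreal_mult')
    also have "\<dots> = indicator {p<..} a * ennreal (normal_tail ((q - \<rho> * a) / sqrt (1 - \<rho>\<^sup>2)))"
      using s by (simp add: nn_integral_cmult normal_density_tail_nn_integral)
    finally show ?thesis
      by (auto simp: indicator_def ennreal_mult normal_tail_nonneg)
  qed
  have "emeasure M {\<omega> \<in> space M. std_normal_cdf p < U \<omega> \<and> std_normal_cdf q < V \<omega>}
      = emeasure M ((\<lambda>\<omega>. (U \<omega>, V \<omega>)) -` ({std_normal_cdf p<..} \<times> {std_normal_cdf q<..}) \<inter> space M)"
    by (intro arg_cong2[where f=emeasure]) auto
  also have "\<dots> = (\<integral>\<^sup>+z. ?c z * indicator ({std_normal_cdf p<..} \<times> {std_normal_cdf q<..}) z \<partial>lborel)"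
    by (intro distributed_emeasure[OF D]) (auto intro!: borel_open open_Times)
  also have "\<dots> = (\<integral>\<^sup>+z. ?c z * indicator ({std_normal_cdf p<..} \<times> {std_normal_cdf q<..}) z
      \<partial>(lborel \<Otimes>\<^sub>M lborel))"
    by (simp add: lborel_prod)
  also have "\<dots> = (\<integral>\<^sup>+u. \<integral>\<^sup>+v. ?c (u, v) *
      indicator ({std_normal_cdf p<..} \<times> {std_normal_cdf q<..}) (u, v) \<partial>lborel \<partial>lborel)"
    by (subst lborel.nn_integral_fst[symmetric]) auto
  also have "\<dots> = (\<integral>\<^sup>+u. indicator {0<..<1} u * H u \<partial>lborel)"
  proof (intro nn_integral_cong)
    fix u :: real
    show "(\<integral>\<^sup>+v. ?c (u, v) * indicator ({std_normal_cdf p<..} \<times> {std_normal_cdf q<..}) (u, v) \<partial>lborel)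
      = indicator {0<..<1} u * H u"
    proof (cases "u \<in> {0<..<1}")
      case True
      then show ?thesis
        unfolding H_def by (auto intro!: nn_integral_cong simp: indicator_def normal_copula_density_def)
    next
      case False
      then have "?c (u, v) = 0" for v by (auto simp: normal_copula_density_def)
      with False show ?thesis by simp
    qed
  qed
  also have "\<dots> = (\<integral>\<^sup>+a. ennreal (std_normal_density a) * H (std_normal_cdf a) \<partial>lborel)"
    by (rule nn_integral_unit_interval_std_normal_cdf) measurable
  finally show ?thesis unfolding H .
qed

text \<open>The probability that two standard normal variables with correlation \<open>\<rho>\<close> exceed \<open>p > 0\<close> and \<open>q\<close>,
  written in the scaled excess of the first over \<open>p\<close>.\<close>
definition joint_tail :: "real \<Rightarrow> real \<Rightarrow> real \<Rightarrow> real" where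
  "joint_tail \<rho> p q = std_normal_density p / p * excess_integral p
     (\<lambda>w. normal_tail ((q - \<rho> * p) / sqrt (1 - \<rho>\<^sup>2) - \<rho> / (p * sqrt (1 - \<rho>\<^sup>2)) * w))"

lemma joint_tail_nonneg:
  assumes "0 < p"
  shows "0 \<le> joint_tail \<rho> p q"
  unfolding joint_tail_def excess_integral_def using assms
  by (intro mult_nonneg_nonneg integral_nonneg_AE) (auto simp: normal_tail_nonneg)

lemma measure_normal_copula_joint_tail:
  assumes D: "distributed M lborel (\<lambda>\<omega>. (U \<omega>, V \<omega>)) (\<lambda>z. ennreal (normal_copula_density \<rho> z))"
    and \<rho>: "-1 < \<rho>" "\<rho> < 1" and p: "0 < p"
  shows "measure M {\<omega> \<in> space M. std_normal_cdf p < U \<omega> \<and> std_normal_cdf q < V \<omega>}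
    = joint_tail \<rho> p q"
proof -
  define \<sigma> where "\<sigma> = sqrt (1 - \<rho>\<^sup>2)"
  from \<rho> have \<sigma>: "0 < \<sigma>" by (simp add: \<sigma>_def abs_square_less_1)
  let ?g = "\<lambda>w. normal_tail ((q - \<rho> * p) / \<sigma> - \<rho> / (p * \<sigma>) * w)"
  have "(q - \<rho> * p) / \<sigma> - \<rho> / (p * \<sigma>) * (p * (a - p)) = (q - \<rho> * a) / \<sigma>" for a
    using p \<sigma> by (simp add: field_simps)
  then have "(\<integral>\<^sup>+a. ennreal (indicator {p<..} a * std_normal_density a
                     * normal_tail ((q - \<rho> * a) / \<sigma>)) \<partial>lborel)
     = ennreal (std_normal_density p / p * excess_integral p ?g)"
    using normal_tail_integral_eq_excess_integral[OF p, of ?g]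
    by (simp add: normal_tail_nonneg normal_tail_le_1)
  then have "emeasure M {\<omega> \<in> space M. std_normal_cdf p < U \<omega> \<and> std_normal_cdf q < V \<omega>}
      = ennreal (joint_tail \<rho> p q)"
    using normal_copula_joint_tail[OF D \<rho>] by (simp add: joint_tail_def \<sigma>_def)
  then show ?thesis
    using joint_tail_nonneg[OF p] by (simp add: measure_def)
qed

text \<open>Inclusion and exclusion: the marginals are uniform by the probability integral transform, and the
  complement of the union of the two events is the joint exceedance.\<close>
lemma normal_copula_cdf:
  assumes M: "prob_space M"
    and X [measurable]: "X \<in> borel_measurable M" and Y [measurable]: "Y \<in> borel_measurable M"
    and F1: "continuous_distribution_function F1" "cdf (distr M borel X) = F1"
    and F2: "continuous_distribution_function F2" "cdf (distr M borel Y) = F2"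
    and D: "distributed M lborel (\<lambda>\<omega>. (F1 (X \<omega>), F2 (Y \<omega>))) (\<lambda>z. ennreal (normal_copula_density \<rho> z))"
    and \<rho>: "-1 < \<rho>" "\<rho> < 1" and p: "0 < p"
  shows "measure M {\<omega> \<in> space M. F1 (X \<omega>) \<le> std_normal_cdf p \<and> F2 (Y \<omega>) \<le> std_normal_cdf q}
    = 1 - normal_tail p - normal_tail q + joint_tail \<rho> p q"
proof -
  interpret prob_space M by fact
  have [measurable]: "F1 \<in> borel_measurable borel" "F2 \<in> borel_measurable borel"
    using F1 F2 by (auto intro!: borel_measurable_continuous_onI
        simp: continuous_distribution_function_def)
  let ?A = "{\<omega> \<in> space M. F1 (X \<omega>) \<le> std_normal_cdf p}"
  let ?B = "{\<omega> \<in> space M. F2 (Y \<omega>) \<le> std_normal_cdf q}"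
  have A: "prob ?A = 1 - normal_tail p"
    using probability_integral_transform[OF F1, of "std_normal_cdf p"]
    by (simp add: std_normal_cdf_bounds measure_distr vimage_def Int_def conj_commute normal_tail_eq_cdf)
  have B: "prob ?B = 1 - normal_tail q"
    using probability_integral_transform[OF F2, of "std_normal_cdf q"]
    by (simp add: std_normal_cdf_bounds measure_distr vimage_def Int_def conj_commute normal_tail_eq_cdf)
  have "prob (?A \<union> ?B) = 1 - joint_tail \<rho> p q"
  proof -
    have "?A \<union> ?B = space M -
        {\<omega> \<in> space M. std_normal_cdf p < F1 (X \<omega>) \<and> std_normal_cdf q < F2 (Y \<omega>)}"
      by auto
    then show ?thesis
      using measure_normal_copula_joint_tail[OF D \<rho> p, of q] by (simp only:) (subst prob_compl, auto)
  qed
  moreover have "prob (?A \<union> ?B) = prob ?A + prob ?B - prob (?A \<inter> ?B)"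
    by (intro measure_Un3) (auto simp: fmeasurable_eq_sets)
  moreover have "?A \<inter> ?B = {\<omega> \<in> space M. F1 (X \<omega>) \<le> std_normal_cdf p \<and> F2 (Y \<omega>) \<le> std_normal_cdf q}"
    by auto
  ultimately show ?thesis using A B by simp
qed

text \<open>Each factor is displayed as \<open>1 + (z + e) / n\<close> with \<open>z = x + y\<close> and a correction \<open>e\<close> equal to \<open>n\<close>
  times the joint tail, which is the shape whose product is close to \<open>exp z\<close>.\<close>
lemma normalized_maxima_cdf_eq_prod:
  assumes row: "normal_copula_row M F1 F2 n \<rho> X Y"
    and F1: "continuous_distribution_function F1" and F2: "continuous_distribution_function F2"
    and n: "0 < n" and p: "0 < p" "normal_tail p = - x / real n" and q: "normal_tail q = - y / real n"
  shows "normalized_maxima_cdf M F1 F2 n X Y x y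
    = (\<Prod>i\<in>{1..n}. 1 + (x + y + real n * joint_tail (\<rho> i) p q) / real n)"
proof -
  interpret prob_space M using row by (simp add: normal_copula_row_def)
  have indep: "indep_vars (\<lambda>_. borel) (\<lambda>i \<omega>. (X i \<omega>, Y i \<omega>)) {1..n}"
    using row by (simp add: normal_copula_row_def)
  have [measurable]: "F1 \<in> borel_measurable borel" "F2 \<in> borel_measurable borel"
    using F1 F2 by (auto intro!: borel_measurable_continuous_onI
        simp: continuous_distribution_function_def)
  define A where "A = {z. F1 (fst z) \<le> std_normal_cdf p \<and> F2 (snd z) \<le> std_normal_cdf q}"
  have A: "A \<in> sets borel"
  proof -
    have "{z \<in> space (borel \<Otimes>\<^sub>M borel). F1 (fst z) \<le> std_normal_cdf p \<and> F2 (snd z) \<le> std_normal_cdf q}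
        \<in> sets (borel \<Otimes>\<^sub>M borel)"
      by measurable
    then show ?thesis unfolding A_def borel_prod[symmetric] by (simp add: space_pair_measure)
  qed
  have max_le: "real n * ((MAX i\<in>{1..n}. f i) - 1) \<le> z \<longleftrightarrow> (\<forall>i\<in>{1..n}. f i \<le> std_normal_cdf r)"
    if "normal_tail r = - z / real n" for f r z
  proof -
    have "std_normal_cdf r = 1 + z / real n" using that by (simp add: normal_tail_eq_cdf)
    moreover have "real n * ((MAX i\<in>{1..n}. f i) - 1) \<le> z \<longleftrightarrow> (MAX i\<in>{1..n}. f i) \<le> 1 + z / real n"
      using n by (simp add: field_simps)
    ultimately show ?thesis using n by (simp add: Max_le_iff)
  qed
  have "normalized_maxima_cdf M F1 F2 n X Y x y
      = prob (\<Inter>i\<in>{1..n}. (\<lambda>\<omega>. (X i \<omega>, Y i \<omega>)) -` A \<inter> space M)"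
    unfolding normalized_maxima_cdf_def max_le[OF p(2)] max_le[OF q] A_def
    using n by (intro arg_cong[where f = prob]) auto
  also have "\<dots> = (\<Prod>i\<in>{1..n}. prob ((\<lambda>\<omega>. (X i \<omega>, Y i \<omega>)) -` A \<inter> space M))"
    using n A by (intro indep_varsD_finite[OF indep]) auto
  also have "\<dots> = (\<Prod>i\<in>{1..n}. 1 + (x + y + real n * joint_tail (\<rho> i) p q) / real n)"
  proof (intro prod.cong refl)
    fix i assume i: "i \<in> {1..n}"
    have XY [measurable]: "(\<lambda>\<omega>. (X i \<omega>, Y i \<omega>)) \<in> M \<rightarrow>\<^sub>M borel \<Otimes>\<^sub>M borel"
      using indep i by (simp add: indep_vars_def borel_prod)
    have meas: "X i \<in> borel_measurable M" "Y i \<in> borel_measurable M"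
      using measurable_compose[OF XY measurable_fst] measurable_compose[OF XY measurable_snd] by auto
    have "(\<lambda>\<omega>. (X i \<omega>, Y i \<omega>)) -` A \<inter> space M
        = {\<omega> \<in> space M. F1 (X i \<omega>) \<le> std_normal_cdf p \<and> F2 (Y i \<omega>) \<le> std_normal_cdf q}"
      by (auto simp: A_def)
    also have "prob \<dots> = 1 - normal_tail p - normal_tail q + joint_tail (\<rho> i) p q"
      using row i p(1) meas F1 F2 prob_space_axioms
      by (intro normal_copula_cdf) (auto simp: normal_copula_row_def)
    also have "\<dots> = 1 + (x + y + real n * joint_tail (\<rho> i) p q) / real n"
      using n p(2) q by (simp add: field_simps)
    finally show "prob ((\<lambda>\<omega>. (X i \<omega>, Y i \<omega>)) -` A \<inter> space M)
        = 1 + (x + y + real n * joint_tail (\<rho> i) p q) / real n" .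
  qed
  finally show ?thesis .
qed

section \<open>Extreme normal quantiles\<close>

lemma normal_quantile_at_top:
  fixes p :: "nat \<Rightarrow> real"
  assumes "\<forall>\<^sub>F n in sequentially. normal_tail (p n) = s / real n"
  shows "filterlim p at_top sequentially"
  unfolding filterlim_at_top_dense
proof
  fix K
  have "(\<lambda>n. s / real n) \<longlonglongrightarrow> 0" by real_asymp
  then have "\<forall>\<^sub>F n in sequentially. s / real n < normal_tail K"
    by (rule order_tendstoD) (rule normal_tail_pos)
  with assms show "\<forall>\<^sub>F n in sequentially. K < p n"
  proof eventually_elim
    case (elim n)
    then show ?case using normal_tail_antimono[of "p n" K] by (cases "K < p n") auto
  qed
qed

text \<open>The Mills ratio at \<open>p n\<close>, with \<open>normal_tail (p n)\<close> replaced by \<open>s / n\<close>.\<close>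
lemma normal_quantile_density_limit:
  fixes p :: "nat \<Rightarrow> real"
  assumes s: "0 < s" and p: "\<forall>\<^sub>F n in sequentially. normal_tail (p n) = s / real n"
  shows "(\<lambda>n. real n * (std_normal_density (p n) / p n)) \<longlonglongrightarrow> s"
proof -
  note top = normal_quantile_at_top[OF p]
  have "(\<lambda>n. 1 / sqrt (2 * pi) * s * inverse (p n * exp ((p n)\<^sup>2 / 2) * normal_tail (p n)))
      \<longlonglongrightarrow> 1 / sqrt (2 * pi) * s * inverse (1 / sqrt (2 * pi))"
    by (intro tendsto_intros mills_ratio_limit top) simp
  moreover have "\<forall>\<^sub>F n in sequentially. 1 / sqrt (2 * pi) * s * inverse (p n * exp ((p n)\<^sup>2 / 2) * normal_tail (p n))
      = real n * (std_normal_density (p n) / p n)"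
    using p eventually_gt_at_top[of 0]
  proof eventually_elim
    case (elim n)
    then have "s = real n * normal_tail (p n)" by simp
    then show ?case
      using normal_tail_pos[of "p n"] by (simp add: std_normal_density_def exp_minus field_simps)
  qed
  ultimately show ?thesis by (auto intro: Lim_transform_eventually)
qed

text \<open>Logarithm of the Mills ratio at \<open>p n\<close>.\<close>
lemma normal_quantile_log_limit:
  fixes p :: "nat \<Rightarrow> real"
  assumes s: "0 < s" and p: "\<forall>\<^sub>F n in sequentially. normal_tail (p n) = s / real n"
  shows "(\<lambda>n. (p n)\<^sup>2 / 2 + ln (p n) - ln (real n)) \<longlonglongrightarrow> - ln (sqrt (2 * pi)) - ln s"
proof -
  note top = normal_quantile_at_top[OF p]
  have "(\<lambda>n. ln (p n * exp ((p n)\<^sup>2 / 2) * normal_tail (p n)) - ln s) \<longlonglongrightarrow> ln (1 / sqrt (2 * pi)) - ln s"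
    by (intro tendsto_intros mills_ratio_limit top) simp
  moreover have "\<forall>\<^sub>F n in sequentially. ln (p n * exp ((p n)\<^sup>2 / 2) * normal_tail (p n)) - ln s
      = (p n)\<^sup>2 / 2 + ln (p n) - ln (real n)"
    using p eventually_gt_at_top[of 0] eventually_compose_filterlim[OF eventually_gt_at_top[of 0] top]
  proof eventually_elim
    case (elim n)
    then show ?case using s by (simp add: ln_mult ln_div)
  qed
  moreover have "ln (1 / sqrt (2 * pi)) = - ln (sqrt (2 * pi))" by (simp add: ln_div)
  ultimately show ?thesis by (simp only:) (auto intro: Lim_transform_eventually)
qed

text \<open>Divide the previous expansion by \<open>(p n)\<^sup>2\<close>, which dominates \<open>ln (p n)\<close>.\<close>
lemma normal_quantile_square_limit:
  fixes p :: "nat \<Rightarrow> real"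
  assumes s: "0 < s" and p: "\<forall>\<^sub>F n in sequentially. normal_tail (p n) = s / real n"
  shows "(\<lambda>n. ln (real n) / (p n)\<^sup>2) \<longlonglongrightarrow> 1 / 2"
proof -
  note top = normal_quantile_at_top[OF p]
  have "((\<lambda>x. ln x / x\<^sup>2) \<longlongrightarrow> 0) (at_top :: real filter)" by real_asymp
  then have 1: "(\<lambda>n. ln (p n) / (p n)\<^sup>2) \<longlonglongrightarrow> 0" by (rule filterlim_compose[OF _ top])
  have "((\<lambda>x. inverse (x\<^sup>2)) \<longlongrightarrow> 0) (at_top :: real filter)" by real_asymp
  then have 2: "(\<lambda>n. inverse ((p n)\<^sup>2)) \<longlonglongrightarrow> 0" by (rule filterlim_compose[OF _ top])
  have "(\<lambda>n. 1 / 2 + ln (p n) / (p n)\<^sup>2 - ((p n)\<^sup>2 / 2 + ln (p n) - ln (real n)) * inverse ((p n)\<^sup>2))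
      \<longlonglongrightarrow> 1 / 2 + 0 - (- ln (sqrt (2 * pi)) - ln s) * 0"
    by (intro tendsto_intros normal_quantile_log_limit[OF s p] 1 2)
  moreover have "\<forall>\<^sub>F n in sequentially. 1 / 2 + ln (p n) / (p n)\<^sup>2
      - ((p n)\<^sup>2 / 2 + ln (p n) - ln (real n)) * inverse ((p n)\<^sup>2) = ln (real n) / (p n)\<^sup>2"
    using eventually_compose_filterlim[OF eventually_gt_at_top[of 0] top]
    by eventually_elim (simp add: field_simps)
  ultimately show ?thesis by (auto intro: Lim_transform_eventually)
qed

text \<open>The error \<open>(p n)\<^sup>2 - 2 ln n\<close> is a bounded term minus \<open>2 ln (p n)\<close>, so its order is only \<open>ln ln n\<close>,
  while \<open>\<mu> n / ln n\<close> is much smaller than \<open>ln ln n / ln n\<close>.\<close>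
lemma normal_quantile_square_error:
  fixes p \<mu> :: "nat \<Rightarrow> real"
  assumes s: "0 < s" and p: "\<forall>\<^sub>F n in sequentially. normal_tail (p n) = s / real n"
    and \<mu>: "(\<lambda>n. \<mu> n / ln (ln (real n))) \<longlonglongrightarrow> 0"
  shows "(\<lambda>n. ((p n)\<^sup>2 - 2 * ln (real n)) * (\<mu> n / ln (real n))) \<longlonglongrightarrow> 0"
proof -
  note top = normal_quantile_at_top[OF p]
  define L where "L n = ln (real n)" for n :: nat
  have L: "filterlim L at_top sequentially" unfolding L_def by real_asymp
  have E: "(\<lambda>n. (p n)\<^sup>2 / 2 + ln (p n) - L n) \<longlonglongrightarrow> - ln (sqrt (2 * pi)) - ln s"
    unfolding L_def by (rule normal_quantile_log_limit[OF s p])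
  have LL: "(\<lambda>n. ln (L n) / L n) \<longlonglongrightarrow> 0" unfolding L_def by real_asymp
  have "((\<lambda>x. 8 * (ln x * ln x / x\<^sup>2)) \<longlongrightarrow> 0) (at_top :: real filter)" by real_asymp
  then have up: "(\<lambda>n. 8 * (ln (p n) * ln (p n) / (p n)\<^sup>2)) \<longlonglongrightarrow> 0" by (rule filterlim_compose[OF _ top])
  have "(\<lambda>n. ln (p n) * (ln (L n) / L n)) \<longlonglongrightarrow> 0"
  proof (rule tendsto_sandwich[OF _ _ tendsto_const up])
    have lim: "(\<lambda>n. L n / (p n)\<^sup>2) \<longlonglongrightarrow> 1 / 2"
      unfolding L_def by (rule normal_quantile_square_limit[OF s p])
    have "\<forall>\<^sub>F n in sequentially. 0 \<le> ln (p n) * (ln (L n) / L n) \<and>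
        ln (p n) * (ln (L n) / L n) \<le> 8 * (ln (p n) * ln (p n) / (p n)\<^sup>2)"
      using order_tendstoD(1)[OF lim, of "1 / 4", simplified]
        order_tendstoD(2)[OF lim, of 1, simplified]
        eventually_compose_filterlim[OF eventually_gt_at_top[of 1] top]
        eventually_compose_filterlim[OF eventually_gt_at_top[of 1] L]
    proof eventually_elim
      case (elim n)
      have lo: "(p n)\<^sup>2 / 4 \<le> L n" and hi: "L n \<le> (p n)\<^sup>2"
        using elim by (auto simp: field_simps)
      have "ln (L n) \<le> ln ((p n)\<^sup>2)" using hi elim by (subst ln_le_cancel_iff) auto
      then have "ln (L n) \<le> 2 * ln (p n)" using elim by (simp add: ln_realpow)
      then have "ln (L n) / L n \<le> 2 * ln (p n) / ((p n)\<^sup>2 / 4)"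
        using lo elim by (intro frac_le) auto
      then have "ln (p n) * (ln (L n) / L n) \<le> ln (p n) * (2 * ln (p n) / ((p n)\<^sup>2 / 4))"
        using elim by (intro mult_left_mono) auto
      then show ?case using elim by (simp add: mult.left_commute)
    qed
    then show "\<forall>\<^sub>F n in sequentially. 0 \<le> ln (p n) * (ln (L n) / L n)"
      "\<forall>\<^sub>F n in sequentially. ln (p n) * (ln (L n) / L n) \<le> 8 * (ln (p n) * ln (p n) / (p n)\<^sup>2)"
      by (auto elim: eventually_mono)
  qed
  then have "(\<lambda>n. (2 * ((p n)\<^sup>2 / 2 + ln (p n) - L n) * (ln (L n) / L n) - 2 * (ln (p n) * (ln (L n) / L n)))
      * (\<mu> n / ln (L n))) \<longlonglongrightarrow> (2 * (- ln (sqrt (2 * pi)) - ln s) * 0 - 2 * 0) * 0"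
    using \<mu> unfolding L_def[symmetric] by (intro tendsto_intros E LL) 
  moreover have "\<forall>\<^sub>F n in sequentially. (2 * ((p n)\<^sup>2 / 2 + ln (p n) - L n) * (ln (L n) / L n)
      - 2 * (ln (p n) * (ln (L n) / L n))) * (\<mu> n / ln (L n)) = ((p n)\<^sup>2 - 2 * L n) * (\<mu> n / L n)"
    using eventually_compose_filterlim[OF eventually_gt_at_top[of 1] L]
  proof eventually_elim
    case (elim n)
    then have "ln (L n) / L n * (\<mu> n / ln (L n)) = \<mu> n / L n" by simp
    moreover have "(2 * ((p n)\<^sup>2 / 2 + ln (p n) - L n) * (ln (L n) / L n)
      - 2 * (ln (p n) * (ln (L n) / L n))) * (\<mu> n / ln (L n))
      = ((p n)\<^sup>2 - 2 * L n) * (ln (L n) / L n * (\<mu> n / ln (L n)))"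
      by algebra
    ultimately show ?case by simp
  qed
  ultimately show ?thesis unfolding L_def by (auto intro: Lim_transform_eventually)
qed

text \<open>Subtracting the logarithmic expansions at the two levels gives \<open>(q n)\<^sup>2 - (p n)\<^sup>2 \<rightarrow> 2 ln (s / t)\<close>,
  because \<open>q n / p n \<rightarrow> 1\<close>; one half of this is lost on dividing by \<open>1 + q n / p n\<close>.\<close>
lemma normal_quantile_difference_limit:
  fixes p q :: "nat \<Rightarrow> real"
  assumes s: "0 < s" and p: "\<forall>\<^sub>F n in sequentially. normal_tail (p n) = s / real n"
    and t: "0 < t" and q: "\<forall>\<^sub>F n in sequentially. normal_tail (q n) = t / real n"
  shows "(\<lambda>n. p n * (q n - p n)) \<longlonglongrightarrow> ln (s / t)"
proof -
  have ptop: "\<forall>\<^sub>F n in sequentially. 0 < p n"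
    by (rule eventually_compose_filterlim[OF eventually_gt_at_top normal_quantile_at_top[OF p]])
  have qtop: "\<forall>\<^sub>F n in sequentially. 0 < q n"
    by (rule eventually_compose_filterlim[OF eventually_gt_at_top normal_quantile_at_top[OF q]])
  have "\<forall>\<^sub>F n :: nat in sequentially. 1 < ln (real n)" by real_asymp
  then have Lpos: "\<forall>\<^sub>F n :: nat in sequentially. 0 < ln (real n)" by eventually_elim simp
  have "(\<lambda>n. sqrt ((ln (real n) / (p n)\<^sup>2) / (ln (real n) / (q n)\<^sup>2))) \<longlonglongrightarrow> sqrt ((1 / 2) / (1 / 2))"
    by (intro tendsto_intros normal_quantile_square_limit[OF s p] normal_quantile_square_limit[OF t q]) simp
  moreover have "\<forall>\<^sub>F n in sequentially. sqrt ((ln (real n) / (p n)\<^sup>2) / (ln (real n) / (q n)\<^sup>2)) = q n / p n"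
    using ptop qtop Lpos
  proof eventually_elim
    case (elim n)
    then have "(ln (real n) / (p n)\<^sup>2) / (ln (real n) / (q n)\<^sup>2) = (q n / p n)\<^sup>2"
      by (simp add: power_divide field_simps)
    with elim show ?case by simp
  qed
  ultimately have ratio: "(\<lambda>n. q n / p n) \<longlonglongrightarrow> 1" by (auto intro: Lim_transform_eventually)
  have "(\<lambda>n. 2 * (((q n)\<^sup>2 / 2 + ln (q n) - ln (real n)) - ((p n)\<^sup>2 / 2 + ln (p n) - ln (real n)) - ln (q n / p n))
        / (1 + q n / p n))
      \<longlonglongrightarrow> 2 * ((- ln (sqrt (2 * pi)) - ln t) - (- ln (sqrt (2 * pi)) - ln s) - ln 1) / (1 + 1)"
    by (intro tendsto_intros normal_quantile_log_limit s p t q ratio) auto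
  moreover have "2 * ((- ln (sqrt (2 * pi)) - ln t) - (- ln (sqrt (2 * pi)) - ln s) - ln 1) / (1 + 1) = ln (s / t)"
    using s t by (simp add: ln_div)
  moreover have "\<forall>\<^sub>F n in sequentially. 2 * (((q n)\<^sup>2 / 2 + ln (q n) - ln (real n))
      - ((p n)\<^sup>2 / 2 + ln (p n) - ln (real n)) - ln (q n / p n)) / (1 + q n / p n) = p n * (q n - p n)"
    using ptop qtop
  proof eventually_elim
    case (elim n)
    then have "p n * (q n - p n) * (1 + q n / p n) = (q n)\<^sup>2 - (p n)\<^sup>2" "0 < 1 + q n / p n"
      by (auto simp: field_simps power2_eq_square add_pos_pos)
    moreover have "2 * (((q n)\<^sup>2 / 2 + ln (q n) - ln (real n))
      - ((p n)\<^sup>2 / 2 + ln (p n) - ln (real n)) - ln (q n / p n)) = (q n)\<^sup>2 - (p n)\<^sup>2"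
      using elim by (simp add: ln_div field_simps)
    ultimately show ?case by (simp only:) (simp add: divide_eq_eq)
  qed
  ultimately show ?thesis by (simp only:) (auto intro: Lim_transform_eventually)
qed

section \<open>The joint tail when the correlation tends to one\<close>

text \<open>With \<open>k = \<mu> / L\<close>, \<open>e = (p\<^sup>2 - 2 L) k\<close> and \<open>a = p (q - p) + e\<close> one has \<open>\<sigma>\<^sup>2 = k (2 - k)\<close> and
  \<open>k p\<^sup>2 = 2 \<mu> + e\<close>, hence \<open>c = (a + 2 \<mu>) / (p \<sigma>)\<close> with \<open>(p \<sigma>)\<^sup>2 = (2 \<mu> + e) (2 - k)\<close>. Since \<open>e\<close>, \<open>k\<close> and
  \<open>\<mu> k\<close> vanish while \<open>a \<rightarrow> \<kappa>\<close>, the limits follow after dividing numerators and denominators by \<open>\<mu>\<close>.\<close>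
lemma correlation_scaling_limits:
  fixes p q r \<mu> L :: "nat \<Rightarrow> real"
  defines "\<rho> n \<equiv> 1 - \<mu> n / L n"
  defines "\<sigma> n \<equiv> sqrt (1 - (\<rho> n)\<^sup>2)"
  defines "c n \<equiv> (q n - \<rho> n * p n) / \<sigma> n" and "d n \<equiv> \<rho> n / (p n * \<sigma> n)"
  assumes p: "filterlim p at_top sequentially" and L: "filterlim L at_top sequentially"
    and \<mu>: "filterlim \<mu> at_top sequentially"
    and pq: "(\<lambda>n. p n * (q n - p n)) \<longlonglongrightarrow> \<kappa>"
    and pL: "(\<lambda>n. ((p n)\<^sup>2 - 2 * L n) * (\<mu> n / L n)) \<longlonglongrightarrow> 0"
    and \<mu>L: "(\<lambda>n. \<mu> n * (\<mu> n / L n)) \<longlonglongrightarrow> 0"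
  shows "(\<lambda>n. (c n)\<^sup>2 - \<mu> n) \<longlonglongrightarrow> \<kappa>" "(\<lambda>n. c n * d n) \<longlonglongrightarrow> 1 / 2"
    "filterlim c at_top sequentially"
proof -
  define k where "k n = \<mu> n / L n" for n
  define e where "e n = ((p n)\<^sup>2 - 2 * L n) * k n" for n
  define a where "a n = p n * (q n - p n) + e n" for n
  define D where "D n = (2 * \<mu> n + e n) * (2 - k n)" for n
  have i\<mu>: "(\<lambda>n. inverse (\<mu> n)) \<longlonglongrightarrow> 0" by (rule tendsto_inverse_0_at_top[OF \<mu>])
  have \<mu>pos: "\<forall>\<^sub>F n in sequentially. 0 < \<mu> n"
    by (rule eventually_compose_filterlim[OF eventually_gt_at_top \<mu>])
  have ppos: "\<forall>\<^sub>F n in sequentially. 0 < p n"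
    by (rule eventually_compose_filterlim[OF eventually_gt_at_top p])
  have Lpos: "\<forall>\<^sub>F n in sequentially. 0 < L n"
    by (rule eventually_compose_filterlim[OF eventually_gt_at_top L])
  have e: "e \<longlonglongrightarrow> 0" using pL by (simp add: e_def[abs_def] k_def)
  have a: "a \<longlonglongrightarrow> \<kappa>" using tendsto_add[OF pq e] by (simp add: a_def[abs_def])
  have k\<mu>: "(\<lambda>n. \<mu> n * k n) \<longlonglongrightarrow> 0" using \<mu>L by (simp add: k_def)
  have k: "k \<longlonglongrightarrow> 0"
  proof (rule Lim_transform_eventually)
    show "(\<lambda>n. \<mu> n * k n * inverse (\<mu> n)) \<longlonglongrightarrow> 0" using tendsto_mult[OF k\<mu> i\<mu>] by simp
  qed (use \<mu>pos in eventually_elim, simp)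
  have kbd: "\<forall>\<^sub>F n in sequentially. 0 < k n \<and> k n < 1"
    using order_tendstoD(2)[OF k, of 1, simplified] \<mu>pos Lpos
    by eventually_elim (simp add: k_def)
  have cd_eq: "\<forall>\<^sub>F n in sequentially. 0 < D n \<and> c n = (a n + 2 * \<mu> n) / (p n * \<sigma> n)
      \<and> (p n * \<sigma> n)\<^sup>2 = D n \<and> 0 < \<sigma> n"
    using \<mu>pos ppos Lpos kbd
  proof eventually_elim
    case (elim n)
    have kL: "k n * L n = \<mu> n" using elim by (simp add: k_def)
    have kp: "k n * (p n)\<^sup>2 = 2 * \<mu> n + e n"
      by (simp add: e_def kL[symmetric] algebra_simps)
    have s: "1 - (\<rho> n)\<^sup>2 = k n * (2 - k n)"
      by (simp add: \<rho>_def k_def[symmetric] power2_eq_square algebra_simps)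
    have spos: "0 < k n * (2 - k n)" using elim by simp
    then have \<sigma>pos: "0 < \<sigma> n" by (simp add: \<sigma>_def s)
    have D: "(p n * \<sigma> n)\<^sup>2 = D n"
      using spos by (simp add: power_mult_distrib \<sigma>_def s D_def kp[symmetric])
    have "(q n - \<rho> n * p n) * p n = a n + 2 * \<mu> n"
      using kp by (simp add: \<rho>_def k_def[symmetric] a_def power2_eq_square algebra_simps)
    then have "c n = (a n + 2 * \<mu> n) / (p n * \<sigma> n)"
      using elim \<sigma>pos unfolding c_def by (simp add: field_simps)
    moreover have "0 < D n" unfolding D[symmetric] using elim \<sigma>pos by simp
    ultimately show ?case using D \<sigma>pos by simp
  qed
  have den: "(\<lambda>n. (2 + e n * inverse (\<mu> n)) * (2 - k n)) \<longlonglongrightarrow> (2 + 0 * 0) * (2 - 0)"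
    by (intro tendsto_intros e i\<mu> k)
  have "(\<lambda>n. ((a n)\<^sup>2 * inverse (\<mu> n) + 4 * a n - 2 * e n + 2 * (\<mu> n * k n) + k n * e n)
        / ((2 + e n * inverse (\<mu> n)) * (2 - k n)))
      \<longlonglongrightarrow> (\<kappa>\<^sup>2 * 0 + 4 * \<kappa> - 2 * 0 + 2 * 0 + 0 * 0) / ((2 + 0 * 0) * (2 - 0))"
    by (intro tendsto_intros a e i\<mu> k k\<mu> den) simp
  then have "(\<lambda>n. ((a n)\<^sup>2 * inverse (\<mu> n) + 4 * a n - 2 * e n + 2 * (\<mu> n * k n) + k n * e n)
        / ((2 + e n * inverse (\<mu> n)) * (2 - k n))) \<longlonglongrightarrow> \<kappa>" by simp
  moreover have "\<forall>\<^sub>F n in sequentially.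
      ((a n)\<^sup>2 * inverse (\<mu> n) + 4 * a n - 2 * e n + 2 * (\<mu> n * k n) + k n * e n)
        / ((2 + e n * inverse (\<mu> n)) * (2 - k n)) = (c n)\<^sup>2 - \<mu> n"
    using \<mu>pos cd_eq
  proof eventually_elim
    case (elim n)
    have num: "\<mu> n * ((a n)\<^sup>2 * inverse (\<mu> n) + 4 * a n - 2 * e n + 2 * (\<mu> n * k n) + k n * e n)
        = (a n + 2 * \<mu> n)\<^sup>2 - \<mu> n * D n"
      using elim by (simp add: D_def power2_eq_square field_simps)
    have den: "\<mu> n * ((2 + e n * inverse (\<mu> n)) * (2 - k n)) = D n"
      using elim by (simp add: D_def field_simps)
    have "(c n)\<^sup>2 - \<mu> n = ((a n + 2 * \<mu> n)\<^sup>2 - \<mu> n * D n) / D n"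
      using elim by (simp add: power_divide diff_divide_distrib)
    also have "\<dots> = ((a n)\<^sup>2 * inverse (\<mu> n) + 4 * a n - 2 * e n + 2 * (\<mu> n * k n) + k n * e n)
        / ((2 + e n * inverse (\<mu> n)) * (2 - k n))"
      unfolding num[symmetric] unfolding den[symmetric] using elim by simp
    finally show ?case by simp
  qed
  ultimately show c2: "(\<lambda>n. (c n)\<^sup>2 - \<mu> n) \<longlonglongrightarrow> \<kappa>" by (rule Lim_transform_eventually)
  have "(\<lambda>n. (a n * inverse (\<mu> n) + 2) * (1 - k n) / ((2 + e n * inverse (\<mu> n)) * (2 - k n)))
      \<longlonglongrightarrow> (\<kappa> * 0 + 2) * (1 - 0) / ((2 + 0 * 0) * (2 - 0))"
    by (intro tendsto_intros a e i\<mu> k den) simp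
  then have "(\<lambda>n. (a n * inverse (\<mu> n) + 2) * (1 - k n) / ((2 + e n * inverse (\<mu> n)) * (2 - k n)))
      \<longlonglongrightarrow> 1 / 2" by simp
  moreover have "\<forall>\<^sub>F n in sequentially.
      (a n * inverse (\<mu> n) + 2) * (1 - k n) / ((2 + e n * inverse (\<mu> n)) * (2 - k n)) = c n * d n"
    using \<mu>pos cd_eq
  proof eventually_elim
    case (elim n)
    have den: "\<mu> n * ((2 + e n * inverse (\<mu> n)) * (2 - k n)) = D n"
      using elim by (simp add: D_def field_simps)
    have num: "\<mu> n * ((a n * inverse (\<mu> n) + 2) * (1 - k n)) = (a n + 2 * \<mu> n) * \<rho> n"
      using elim by (simp add: \<rho>_def k_def[symmetric] field_simps)
    have "c n * d n = (a n + 2 * \<mu> n) * \<rho> n / (p n * \<sigma> n)\<^sup>2"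
      using elim by (simp add: d_def power2_eq_square)
    also have "\<dots> = (a n + 2 * \<mu> n) * \<rho> n / D n" using elim by simp
    also have "\<dots> = (a n * inverse (\<mu> n) + 2) * (1 - k n) / ((2 + e n * inverse (\<mu> n)) * (2 - k n))"
      unfolding num[symmetric] unfolding den[symmetric] using elim by simp
    finally show ?case by simp
  qed
  ultimately show "(\<lambda>n. c n * d n) \<longlonglongrightarrow> 1 / 2" by (rule Lim_transform_eventually)
  have "filterlim (\<lambda>n. (c n)\<^sup>2) at_top sequentially"
    using filterlim_tendsto_add_at_top[OF c2 \<mu>] by simp
  then have "filterlim (\<lambda>n. sqrt ((c n)\<^sup>2)) at_top sequentially"
    by (rule filterlim_compose[OF sqrt_at_top])
  moreover have "\<forall>\<^sub>F n in sequentially. sqrt ((c n)\<^sup>2) = c n"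
  proof -
    have "filterlim (\<lambda>n. a n + 2 * \<mu> n) at_top sequentially"
      by (intro filterlim_tendsto_add_at_top[OF a] filterlim_tendsto_pos_mult_at_top[OF tendsto_const] \<mu>) simp
    then have "\<forall>\<^sub>F n in sequentially. 0 < a n + 2 * \<mu> n"
      by (rule eventually_compose_filterlim[OF eventually_gt_at_top])
    with cd_eq ppos show ?thesis by eventually_elim simp
  qed
  ultimately show "filterlim c at_top sequentially"
    by (rule filterlim_cong[THEN iffD1, OF refl refl, rotated])
qed

text \<open>The dominating function. While \<open>c - d w \<ge> c / 2\<close>, the Mills bound on the tail cancels the factor
  \<open>c exp (c\<^sup>2 / 2)\<close> up to \<open>exp (c d w)\<close>. Afterwards \<open>w > c / (2 d)\<close>, which is at least \<open>8 / 9 c\<^sup>2\<close>, so \<open>exp (3 / 4 w)\<close> is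
  at least \<open>exp (2 / 3 c\<^sup>2)\<close> and dominates the whole factor, as \<open>2 / 3 = 1 / 2 + 1 / 6\<close>. The
  bound \<open>9 / 16\<close> on \<open>c d\<close> leaves room above the limit \<open>1 / 2\<close>.\<close>
lemma scaled_normal_tail_bound:
  assumes c: "0 < c" "c \<le> exp (c\<^sup>2 / 6)" and cd: "0 < c * d" "c * d \<le> 9 / 16" and w: "0 < w"
  shows "c * exp (c\<^sup>2 / 2) * normal_tail (c - d * w) \<le> exp (3 / 4 * w)"
proof (cases "d * w \<le> c / 2")
  case True
  define t where "t = c - d * w"
  have t: "c / 2 \<le> t" "0 < t" using True c by (auto simp: t_def)
  have pi: "2 \<le> sqrt (2 * pi)" using pi_gt3 by (intro real_le_rsqrt) simp
  have "c * normal_tail t \<le> c * (std_normal_density t / t)"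
    using normal_tail_le[OF t(2)] c by (intro mult_left_mono) auto
  also have "\<dots> = (c / t) / sqrt (2 * pi) * exp (- t\<^sup>2 / 2)"
    by (simp add: std_normal_density_def)
  also have "\<dots> \<le> 1 * exp (- t\<^sup>2 / 2)"
  proof (intro mult_right_mono)
    have "c / 2 * 2 \<le> t * sqrt (2 * pi)"
      using t c pi by (intro mult_mono) auto
    then have "c \<le> t * sqrt (2 * pi)" by simp
    with t(2) show "c / t / sqrt (2 * pi) \<le> 1" by (simp add: divide_le_eq)
  qed simp
  finally have "exp (c\<^sup>2 / 2) * (c * normal_tail t) \<le> exp (c\<^sup>2 / 2) * exp (- t\<^sup>2 / 2)"
    by (intro mult_left_mono) auto
  also have "\<dots> = exp (c * d * w - (d * w)\<^sup>2 / 2)"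
  proof -
    have "c\<^sup>2 / 2 + - t\<^sup>2 / 2 = c * d * w - (d * w)\<^sup>2 / 2"
      by (simp add: t_def power2_eq_square field_simps)
    then show ?thesis by (simp only: mult_exp_exp)
  qed
  also have "c * d * w - (d * w)\<^sup>2 / 2 \<le> 9 / 16 * w"
    using mult_right_mono[OF cd(2), of w] w zero_le_power2[of "d * w"] by linarith
  also have "\<dots> \<le> 3 / 4 * w" using w by simp
  finally show ?thesis by (simp add: t_def mult_ac)
next
  case False
  have "8 / 9 * (c * c) \<le> w"
  proof -
    have "c * (c / 2) \<le> c * (d * w)" using False c by (intro mult_left_mono) auto
    also have "\<dots> \<le> 9 / 16 * w" using mult_right_mono[OF cd(2), of w] w by (simp add: mult_ac)
    finally show ?thesis by simp
  qed
  then have w': "c\<^sup>2 / 6 + c\<^sup>2 / 2 \<le> 3 / 4 * w" by (simp add: power2_eq_square)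
  have "c * exp (c\<^sup>2 / 2) * normal_tail (c - d * w) \<le> exp (c\<^sup>2 / 6) * exp (c\<^sup>2 / 2) * 1"
    using c by (intro mult_mono) (auto simp: normal_tail_nonneg normal_tail_le_1)
  also have "\<dots> = exp (c\<^sup>2 / 6 + c\<^sup>2 / 2)"
    by (simp only: exp_add mult_1_right)
  also have "\<dots> \<le> exp (3 / 4 * w)"
    using w' by (simp only: exp_le_cancel_iff)
  finally show ?thesis .
qed

text \<open>Pointwise, \<open>c exp (c\<^sup>2 / 2) Q (c - d w)\<close> tends to \<open>exp (w / 2) / sqrt (2 pi)\<close>, because
  \<open>(c - d w)\<^sup>2 / 2 = c\<^sup>2 / 2 - c d w + (d w)\<^sup>2 / 2\<close> with \<open>c d \<rightarrow> 1 / 2\<close> and \<open>d \<rightarrow> 0\<close>. The limit of the integrals is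
  that of \<open>exp (- w / 2) / sqrt (2 pi)\<close>, whose integral gives the factor \<open>2\<close>.\<close>
lemma excess_integral_normal_tail_limit:
  fixes c d p :: "nat \<Rightarrow> real"
  assumes c: "filterlim c at_top sequentially" and p: "filterlim p at_top sequentially"
    and cd: "(\<lambda>n. c n * d n) \<longlonglongrightarrow> 1 / 2"
  shows "(\<lambda>n. c n * exp ((c n)\<^sup>2 / 2) * excess_integral (p n) (\<lambda>w. normal_tail (c n - d n * w)))
         \<longlonglongrightarrow> 2 / sqrt (2 * pi)"
proof -
  have c0: "\<forall>\<^sub>F n in sequentially. 0 < c n"
    by (rule eventually_compose_filterlim[OF eventually_gt_at_top c])
  have ic: "(\<lambda>n. inverse (c n)) \<longlonglongrightarrow> 0"
    by (rule tendsto_inverse_0_at_top[OF c])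
  have d: "d \<longlonglongrightarrow> 0"
  proof (rule Lim_transform_eventually)
    show "(\<lambda>n. c n * d n * inverse (c n)) \<longlonglongrightarrow> 0"
      using tendsto_mult[OF cd ic] by simp
  qed (use c0 in eventually_elim, simp)
  have pointwise: "(\<lambda>n. c n * exp ((c n)\<^sup>2 / 2) * normal_tail (c n - d n * w))
      \<longlonglongrightarrow> 1 / sqrt (2 * pi) * exp (w / 2)" for w
  proof -
    define t where "t n = c n - d n * w" for n
    have t: "filterlim t at_top sequentially"
    proof -
      have "filterlim (\<lambda>n. - (d n * w) + c n) at_top sequentially"
        by (rule filterlim_tendsto_add_at_top[OF tendsto_minus[OF tendsto_mult_left_zero[OF d]] c])
      then show ?thesis by (simp add: t_def[abs_def])
    qed
    have "(\<lambda>n. t n * exp ((t n)\<^sup>2 / 2) * normal_tail (t n) * inverse (1 - d n * w * inverse (c n))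
        * exp (c n * d n * w - (d n * w)\<^sup>2 / 2))
      \<longlonglongrightarrow> 1 / sqrt (2 * pi) * inverse (1 - 0 * w * 0) * exp (1 / 2 * w - (0 * w)\<^sup>2 / 2)"
      by (intro tendsto_intros mills_ratio_limit t d ic cd) auto
    moreover have "\<forall>\<^sub>F n in sequentially. t n * exp ((t n)\<^sup>2 / 2) * normal_tail (t n) *
        inverse (1 - d n * w * inverse (c n)) * exp (c n * d n * w - (d n * w)\<^sup>2 / 2)
      = c n * exp ((c n)\<^sup>2 / 2) * normal_tail (c n - d n * w)"
      using c0 eventually_compose_filterlim[OF eventually_gt_at_top[of 0] t]
    proof eventually_elim
      case (elim n)
      have 1: "t n * inverse (1 - d n * w * inverse (c n)) = c n"
        using elim by (simp add: t_def field_simps)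
      have "(t n)\<^sup>2 / 2 + (c n * d n * w - (d n * w)\<^sup>2 / 2) = (c n)\<^sup>2 / 2"
        by (simp add: t_def power2_eq_square field_simps)
      then have 2: "exp ((t n)\<^sup>2 / 2) * exp (c n * d n * w - (d n * w)\<^sup>2 / 2) = exp ((c n)\<^sup>2 / 2)"
        by (simp only: mult_exp_exp)
      have "t n * exp ((t n)\<^sup>2 / 2) * normal_tail (t n) *
          inverse (1 - d n * w * inverse (c n)) * exp (c n * d n * w - (d n * w)\<^sup>2 / 2)
        = (t n * inverse (1 - d n * w * inverse (c n))) *
          (exp ((t n)\<^sup>2 / 2) * exp (c n * d n * w - (d n * w)\<^sup>2 / 2)) * normal_tail (t n)"
        by (simp only: mult_ac)
      then show ?case unfolding 1 2 by (simp only: t_def)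
    qed
    ultimately show ?thesis by (auto intro: Lim_transform_eventually)
  qed
  define g where "g n w = c n * exp ((c n)\<^sup>2 / 2) * normal_tail (c n - d n * w)" for n w
  have "(\<lambda>n. excess_integral (p n) (g n)) \<longlonglongrightarrow>
      (LINT w|lborel. indicator {0<..} w * exp (- w) * (1 / sqrt (2 * pi) * exp (w / 2)))"
  proof (rule excess_integral_dominated_convergence[OF _ _ p, where b = "3 / 4"])
    show "(\<lambda>n. g n w) \<longlonglongrightarrow> 1 / sqrt (2 * pi) * exp (w / 2)" for w
      unfolding g_def by (rule pointwise)
    have "\<forall>\<^sub>F x :: real in at_top. x \<le> exp (x\<^sup>2 / 6)" by real_asymp
    then have "\<forall>\<^sub>F n in sequentially. c n \<le> exp ((c n)\<^sup>2 / 6)"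
      by (rule eventually_compose_filterlim[OF _ c])
    moreover have "\<forall>\<^sub>F n in sequentially. 0 < c n * d n" "\<forall>\<^sub>F n in sequentially. c n * d n < 9 / 16"
      using order_tendstoD(1)[OF cd, of 0] order_tendstoD(2)[OF cd, of "9 / 16"] by auto
    ultimately show "\<forall>\<^sub>F n in sequentially. \<forall>w>0. \<bar>g n w\<bar> \<le> exp (3 / 4 * w)"
      using c0
    proof eventually_elim
      case (elim n)
      then show ?case
        using scaled_normal_tail_bound[of "c n" "d n"]
        by (simp add: g_def abs_mult normal_tail_nonneg)
    qed
  qed (auto simp: g_def[abs_def])
  moreover have "excess_integral (p n) (g n) = c n * exp ((c n)\<^sup>2 / 2) *
      excess_integral (p n) (\<lambda>w. normal_tail (c n - d n * w))" for n
    unfolding excess_integral_def g_def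
    by (subst integral_mult_right_zero[symmetric]) (simp only: mult_ac)
  moreover have "(LINT w|lborel. indicator {0<..} w * exp (- w) * (1 / sqrt (2 * pi) * exp (w / 2)))
      = 2 / sqrt (2 * pi)"
  proof -
    have "(LINT w|lborel. indicator {0<..} w * exp (- w) * (1 / sqrt (2 * pi) * exp (w / 2)))
      = (LINT w|lborel. 1 / sqrt (2 * pi) * (indicator {0<..} w * exp (- (1 / 2 * w))))"
    proof (intro Bochner_Integration.integral_cong refl)
      fix w :: real
      have "exp (- w) * exp (w / 2) = exp (- (1 / 2 * w))" by (simp add: mult_exp_exp)
      then show "indicator {0<..} w * exp (- w) * (1 / sqrt (2 * pi) * exp (w / 2))
        = 1 / sqrt (2 * pi) * (indicator {0<..} w * exp (- (1 / 2 * w)))"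
        by (simp only: mult.assoc mult.left_commute[of _ "1 / sqrt (2 * pi)"])
    qed
    also have "\<dots> = 1 / sqrt (2 * pi) * 2"
      using has_bochner_integral_exp_half_line[of "1 / 2"]
      by (subst integral_mult_right_zero) (simp add: has_bochner_integral_iff)
    finally show ?thesis by simp
  qed
  ultimately show ?thesis by (simp only:)
qed

text \<open>The quantity splits into \<open>sqrt \<mu> / c\<close>, which tends to \<open>1\<close>, then \<open>exp ((\<mu> - c\<^sup>2) / 2)\<close>, which tends to
  \<open>sqrt (t / s)\<close>, the density factor with limit \<open>s\<close>, and the excess integral with limit
  \<open>2 / sqrt (2 pi)\<close>.\<close>
lemma joint_tail_limit:
  fixes p q \<mu> :: "nat \<Rightarrow> real"
  assumes s: "0 < s" and p: "\<forall>\<^sub>F n in sequentially. normal_tail (p n) = s / real n"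
    and t: "0 < t" and q: "\<forall>\<^sub>F n in sequentially. normal_tail (q n) = t / real n"
    and \<mu>: "filterlim \<mu> at_top sequentially" and \<mu>L: "(\<lambda>n. \<mu> n / ln (ln (real n))) \<longlonglongrightarrow> 0"
  shows "(\<lambda>n. sqrt (\<mu> n) * exp (\<mu> n / 2) * (real n * joint_tail (1 - \<mu> n / ln (real n)) (p n) (q n)))
         \<longlonglongrightarrow> sqrt (2 / pi) * sqrt (s * t)"
proof -
  define \<rho> where "\<rho> n = 1 - \<mu> n / ln (real n)" for n
  define c where "c n = (q n - \<rho> n * p n) / sqrt (1 - (\<rho> n)\<^sup>2)" for n
  define d where "d n = \<rho> n / (p n * sqrt (1 - (\<rho> n)\<^sup>2))" for n
  note ptop = normal_quantile_at_top[OF p]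
  have L: "filterlim (\<lambda>n. ln (real n)) at_top sequentially" by real_asymp
  have "(\<lambda>n. (\<mu> n / ln (ln (real n)))\<^sup>2 * ((ln (ln (real n)))\<^sup>2 / ln (real n))) \<longlonglongrightarrow> 0\<^sup>2 * 0"
    by (intro tendsto_mult tendsto_power \<mu>L) real_asymp
  moreover have "\<forall>\<^sub>F n in sequentially. (\<mu> n / ln (ln (real n)))\<^sup>2 * ((ln (ln (real n)))\<^sup>2 / ln (real n))
      = \<mu> n * (\<mu> n / ln (real n))"
    using eventually_compose_filterlim[OF eventually_gt_at_top[of 1] L]
    by eventually_elim (simp add: power2_eq_square)
  ultimately have \<mu>2: "(\<lambda>n. \<mu> n * (\<mu> n / ln (real n))) \<longlonglongrightarrow> 0"
    by (auto intro: Lim_transform_eventually)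
  have c2: "(\<lambda>n. (c n)\<^sup>2 - \<mu> n) \<longlonglongrightarrow> ln (s / t)" and cd: "(\<lambda>n. c n * d n) \<longlonglongrightarrow> 1 / 2"
    and c: "filterlim c at_top sequentially"
    unfolding c_def d_def \<rho>_def
    using correlation_scaling_limits[OF ptop L \<mu> normal_quantile_difference_limit[OF s p t q]
        normal_quantile_square_error[OF s p \<mu>L] \<mu>2]
    by simp_all
  have i\<mu>: "(\<lambda>n. inverse (\<mu> n)) \<longlonglongrightarrow> 0" by (rule tendsto_inverse_0_at_top[OF \<mu>])
  have "(\<lambda>n. inverse (sqrt (1 + ((c n)\<^sup>2 - \<mu> n) * inverse (\<mu> n))) * exp (- ((c n)\<^sup>2 - \<mu> n) / 2) *
        (real n * (std_normal_density (p n) / p n)) *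
        (c n * exp ((c n)\<^sup>2 / 2) * excess_integral (p n) (\<lambda>w. normal_tail (c n - d n * w))))
      \<longlonglongrightarrow> inverse (sqrt (1 + ln (s / t) * 0)) * exp (- ln (s / t) / 2) * s * (2 / sqrt (2 * pi))"
    by (intro tendsto_intros c2 i\<mu> normal_quantile_density_limit[OF s p]
        excess_integral_normal_tail_limit[OF c ptop cd]) simp_all
  moreover have "inverse (sqrt (1 + ln (s / t) * 0)) * exp (- ln (s / t) / 2) * s * (2 / sqrt (2 * pi))
      = sqrt (2 / pi) * sqrt (s * t)"
  proof -
    have "- ln (s / t) / 2 = ln (sqrt (t / s))"
      using s t by (simp add: ln_sqrt ln_div)
    then have "exp (- ln (s / t) / 2) = sqrt (t / s)"
      using s t by (simp only:) simp
    then have "exp (- ln (s / t) / 2) * s = sqrt (t / s) * sqrt (s * s)"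
      using s by simp
    also have "\<dots> = sqrt (t / s * (s * s))" by (simp only: real_sqrt_mult)
    also have "\<dots> = sqrt (s * t)" using s by simp
    finally have "exp (- ln (s / t) / 2) * s = sqrt (s * t)" .
    moreover have "2 / sqrt (2 * pi) = sqrt (2 / pi)"
      by (simp add: real_sqrt_mult real_sqrt_divide field_simps)
    ultimately show ?thesis by simp
  qed
  moreover have "\<forall>\<^sub>F n in sequentially.
        inverse (sqrt (1 + ((c n)\<^sup>2 - \<mu> n) * inverse (\<mu> n))) * exp (- ((c n)\<^sup>2 - \<mu> n) / 2) *
        (real n * (std_normal_density (p n) / p n)) *
        (c n * exp ((c n)\<^sup>2 / 2) * excess_integral (p n) (\<lambda>w. normal_tail (c n - d n * w)))
      = sqrt (\<mu> n) * exp (\<mu> n / 2) * (real n * joint_tail (\<rho> n) (p n) (q n))"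
    using eventually_compose_filterlim[OF eventually_gt_at_top[of 0] c]
      eventually_compose_filterlim[OF eventually_gt_at_top[of 0] \<mu>]
  proof eventually_elim
    case (elim n)
    have "1 + ((c n)\<^sup>2 - \<mu> n) * inverse (\<mu> n) = (c n)\<^sup>2 / \<mu> n"
      using elim by (simp add: field_simps)
    then have 1: "inverse (sqrt (1 + ((c n)\<^sup>2 - \<mu> n) * inverse (\<mu> n))) * c n = sqrt (\<mu> n)"
      using elim by (simp add: real_sqrt_divide)
    have "- ((c n)\<^sup>2 - \<mu> n) / 2 + (c n)\<^sup>2 / 2 = \<mu> n / 2" by (simp add: field_simps)
    then have 2: "exp (- ((c n)\<^sup>2 - \<mu> n) / 2) * exp ((c n)\<^sup>2 / 2) = exp (\<mu> n / 2)"
      by (simp only: mult_exp_exp)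
    show ?case
      unfolding joint_tail_def c_def[symmetric] d_def[symmetric] 1[symmetric] 2[symmetric]
      by (simp only: mult_ac)
  qed
  ultimately show ?thesis unfolding \<rho>_def by (simp only:) (auto intro: Lim_transform_eventually)
qed

section \<open>Products over the rows of a triangular array\<close>

text \<open>Apply the hypothesis to an index \<open>j n\<close> at which the deviation from \<open>l\<close> is largest in row \<open>n\<close>.\<close>
lemma uniform_over_rows:
  fixes f :: "nat \<Rightarrow> nat \<Rightarrow> real"
  assumes "\<And>j. (\<And>n. 0 < n \<Longrightarrow> j n \<in> {1..n}) \<Longrightarrow> (\<lambda>n. f n (j n)) \<longlonglongrightarrow> l" and "0 < \<epsilon>"
  shows "\<forall>\<^sub>F n in sequentially. \<forall>i\<in>{1..n}. \<bar>f n i - l\<bar> < \<epsilon>"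
proof -
  have "\<exists>k. 0 < n \<longrightarrow> k \<in> {1..n} \<and> (\<forall>i\<in>{1..n}. \<bar>f n i - l\<bar> \<le> \<bar>f n k - l\<bar>)" for n
  proof (cases "0 < n")
    case True
    then have "Max ((\<lambda>i. \<bar>f n i - l\<bar>) ` {1..n}) \<in> (\<lambda>i. \<bar>f n i - l\<bar>) ` {1..n}"
      by (intro Max_in) auto
    then obtain k where "k \<in> {1..n}" "Max ((\<lambda>i. \<bar>f n i - l\<bar>) ` {1..n}) = \<bar>f n k - l\<bar>" by auto
    then show ?thesis by (metis Max_ge finite_atLeastAtMost finite_imageI imageI)
  qed simp
  then obtain j where j: "\<And>n. 0 < n \<Longrightarrow> j n \<in> {1..n}"
    "\<And>n i. 0 < n \<Longrightarrow> i \<in> {1..n} \<Longrightarrow> \<bar>f n i - l\<bar> \<le> \<bar>f n (j n) - l\<bar>"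
    by metis
  have "(\<lambda>n. f n (j n)) \<longlonglongrightarrow> l" by (intro assms(1) j(1))
  from tendstoD[OF this \<open>0 < \<epsilon>\<close>]
  have "\<forall>\<^sub>F n in sequentially. \<bar>f n (j n) - l\<bar> < \<epsilon>" by (simp add: dist_real_def)
  with eventually_gt_at_top[of 0] show ?thesis
  proof eventually_elim
    case (elim n)
    then show ?case using j(2)[of n] by (meson le_less_trans)
  qed
qed

text \<open>The difference quotient of \<open>exp\<close> at \<open>0\<close>, completed by its limit \<open>1\<close>: the increments \<open>w n\<close> may
  vanish.\<close>
lemma exp_increment_limit:
  fixes w a :: "nat \<Rightarrow> real"
  assumes w: "(\<lambda>n. w n / a n) \<longlonglongrightarrow> K" and a: "a \<longlonglongrightarrow> 0" and pos: "\<forall>\<^sub>F n in sequentially. 0 < a n"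
  shows "(\<lambda>n. (exp (w n) - 1) / a n) \<longlonglongrightarrow> K"
proof -
  \<comment> \<open>The value at \<open>0\<close> makes \<open>h\<close> continuous and \<open>h v * v = exp v - 1\<close> valid for every \<open>v\<close>.\<close>
  define h where "h v = (if v = 0 then 1 else (exp v - 1) / v)" for v :: real
  have "(h \<longlongrightarrow> 1) (at 0)"
    by (rule Lim_transform_eventually[OF lim_exp_minus_1])
       (auto simp: h_def eventually_at_filter)
  then have cont: "isCont h 0" by (simp add: isCont_def h_def)
  have "(\<lambda>n. w n / a n * a n) \<longlonglongrightarrow> K * 0" by (intro tendsto_mult w a)
  moreover have "\<forall>\<^sub>F n in sequentially. w n / a n * a n = w n"
    using pos by eventually_elim simp
  ultimately have "w \<longlonglongrightarrow> 0" by (auto intro: Lim_transform_eventually)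
  then have "(\<lambda>n. h (w n)) \<longlonglongrightarrow> h 0" by (rule isCont_tendsto_compose[OF cont])
  then have "(\<lambda>n. h (w n) * (w n / a n)) \<longlonglongrightarrow> 1 * K"
    by (intro tendsto_mult w) (simp add: h_def)
  moreover have "h (w n) * (w n / a n) = (exp (w n) - 1) / a n" for n
    by (simp add: h_def)
  ultimately show ?thesis by (simp only: mult_1)
qed

text \<open>The logarithm of the product is \<open>z\<close> plus the average of the \<open>e n i\<close>, up to the sum of \<open>n\<close> squares of
  order \<open>1 / n\<^sup>2\<close>. The average is asymptotically \<open>K a n\<close>, and the lower bound \<open>1 / ln n\<close> on the weights
  makes the error of order \<open>1 / n\<close> negligible against \<open>a n\<close>.\<close>
lemma triangular_product_limit:
  fixes e g :: "nat \<Rightarrow> nat \<Rightarrow> real"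
  defines "a n \<equiv> 1 / real n * (\<Sum>i=1..n. g n i)"
  assumes g_small: "\<And>\<epsilon>. 0 < \<epsilon> \<Longrightarrow> \<forall>\<^sub>F n in sequentially. \<forall>i\<in>{1..n}. g n i < \<epsilon>"
    and g_lower: "\<forall>\<^sub>F n in sequentially. \<forall>i\<in>{1..n}. 1 / ln (real n) \<le> g n i"
    and e: "\<And>\<epsilon>. 0 < \<epsilon> \<Longrightarrow> \<forall>\<^sub>F n in sequentially. \<forall>i\<in>{1..n}. \<bar>e n i / g n i - K\<bar> < \<epsilon>"
  shows "(\<lambda>n. inverse (a n) * ((\<Prod>i\<in>{1..n}. 1 + (z + e n i) / real n) - exp z)) \<longlonglongrightarrow> K * exp z"
proof -
  have ln_pos: "\<forall>\<^sub>F n :: nat in sequentially. 0 < ln (real n)" by real_asymp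
  have g_pos: "\<forall>\<^sub>F n in sequentially. \<forall>i\<in>{1..n}. 0 < g n i"
    using g_lower ln_pos
    by eventually_elim (meson divide_pos_pos less_le_trans zero_less_one)
  have a_lower: "\<forall>\<^sub>F n in sequentially. 1 / ln (real n) \<le> a n"
    using g_lower eventually_gt_at_top[of 0]
  proof eventually_elim
    case (elim n)
    have "real (card {1..n}) * (1 / ln (real n)) \<le> (\<Sum>i=1..n. g n i)"
      using elim by (intro sum_bounded_below) auto
    with elim show ?case by (simp add: a_def field_simps)
  qed
  have a_pos: "\<forall>\<^sub>F n in sequentially. 0 < a n"
    using a_lower ln_pos by eventually_elim (meson divide_pos_pos less_le_trans zero_less_one)
  have a: "a \<longlonglongrightarrow> 0"
  proof (rule order_tendstoI)
    fix b :: real assume "b < 0"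
    then show "\<forall>\<^sub>F n in sequentially. b < a n" using a_pos by (auto elim: eventually_mono)
  next
    fix b :: real assume "0 < b"
    then have "\<forall>\<^sub>F n in sequentially. \<forall>i\<in>{1..n}. g n i < b / 2" by (intro g_small) simp
    with eventually_gt_at_top[of 0] show "\<forall>\<^sub>F n in sequentially. a n < b"
    proof eventually_elim
      case (elim n)
      have "(\<Sum>i=1..n. g n i) \<le> real (card {1..n}) * (b / 2)"
        using elim by (intro sum_bounded_above) (auto intro: less_imp_le)
      also have "\<dots> < real n * b" using elim \<open>0 < b\<close> by simp
      finally show ?case using elim by (simp add: a_def field_simps)
    qed
  qed
  define T where "T n = 1 / real n * (\<Sum>i=1..n. e n i)" for n
  have T: "(\<lambda>n. T n / a n) \<longlonglongrightarrow> K"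
  proof (rule tendstoI)
    fix \<epsilon> :: real assume "0 < \<epsilon>"
    then have "\<forall>\<^sub>F n in sequentially. \<forall>i\<in>{1..n}. \<bar>e n i / g n i - K\<bar> < \<epsilon> / 2" by (intro e) simp
    with g_pos a_pos eventually_gt_at_top[of 0] show "\<forall>\<^sub>F n in sequentially. dist (T n / a n) K < \<epsilon>"
    proof eventually_elim
      case (elim n)
      have "T n - K * a n = 1 / real n * (\<Sum>i=1..n. e n i - K * g n i)"
        by (simp add: T_def a_def sum_subtractf sum_distrib_left right_diff_distrib mult_ac)
      also have "\<bar>\<dots>\<bar> \<le> 1 / real n * (\<Sum>i=1..n. \<bar>e n i - K * g n i\<bar>)"
        using sum_abs[of "\<lambda>i. e n i - K * g n i" "{1..n}"] by (simp add: abs_mult divide_right_mono)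
      also have "\<dots> \<le> 1 / real n * (\<Sum>i=1..n. \<epsilon> / 2 * g n i)"
      proof (intro mult_left_mono sum_mono)
        fix i assume i: "i \<in> {1..n}"
        with elim have gi: "0 < g n i" and "\<bar>e n i / g n i - K\<bar> < \<epsilon> / 2" by auto
        then have "\<bar>e n i / g n i - K\<bar> * g n i \<le> \<epsilon> / 2 * g n i" by (intro mult_right_mono) auto
        also have "\<bar>e n i / g n i - K\<bar> * g n i = \<bar>(e n i / g n i - K) * g n i\<bar>"
          using gi by (simp add: abs_mult)
        also have "(e n i / g n i - K) * g n i = e n i - K * g n i" using gi by (simp add: field_simps)
        finally show "\<bar>e n i - K * g n i\<bar> \<le> \<epsilon> / 2 * g n i" .
      qed simp
      also have "\<dots> = 1 / real n * (\<epsilon> / 2 * (\<Sum>i=1..n. g n i))"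
        by (simp only: sum_distrib_left)
      also have "\<dots> = \<epsilon> / 2 * a n" by (simp add: a_def)
      also have "\<dots> < \<epsilon> * a n" using \<open>0 < \<epsilon>\<close> elim by simp
      finally have "\<bar>T n - K * a n\<bar> / a n < \<epsilon>" using elim by (simp add: pos_divide_less_eq)
      also have "\<bar>T n - K * a n\<bar> / a n = \<bar>T n / a n - K\<bar>"
      proof -
        have "T n / a n - K = (T n - K * a n) / a n" using elim by (simp add: diff_divide_distrib)
        with elim show ?thesis by simp
      qed
      finally show ?case by (simp add: dist_real_def)
    qed
  qed
  define W where "W n = (\<Sum>i=1..n. ln (1 + (z + e n i) / real n)) - z" for n
  define B where "B = \<bar>z\<bar> + \<bar>K\<bar> + 1"
  have e_bound: "\<forall>\<^sub>F n in sequentially. \<forall>i\<in>{1..n}. \<bar>z + e n i\<bar> \<le> B"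
    using g_pos g_small[of 1, simplified] e[of 1, simplified]
  proof eventually_elim
    case (elim n)
    show ?case
    proof
      fix i assume i: "i \<in> {1..n}"
      with elim have gi: "0 < g n i" "g n i < 1" and d: "\<bar>e n i / g n i - K\<bar> < 1" by auto
      have "\<bar>e n i\<bar> = \<bar>e n i / g n i\<bar> * g n i" using gi by simp
      also have "\<dots> \<le> \<bar>e n i / g n i\<bar> * 1" using gi by (intro mult_left_mono) auto
      also have "\<dots> \<le> \<bar>K\<bar> + 1" using d by simp
      finally show "\<bar>z + e n i\<bar> \<le> B" by (simp add: B_def)
    qed
  qed
  have "(\<lambda>n. B / real n) \<longlonglongrightarrow> 0" by real_asymp
  then have B_small: "\<forall>\<^sub>F n in sequentially. B / real n < 1 / 2" by (rule order_tendstoD) simp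
  have small: "\<forall>\<^sub>F n in sequentially. 0 < n \<and> (\<forall>i\<in>{1..n}. \<bar>(z + e n i) / real n\<bar> \<le> B / real n \<and> B / real n < 1 / 2)"
    using e_bound B_small eventually_gt_at_top[of 0]
    by eventually_elim (auto simp: divide_right_mono)
  have "(\<lambda>n. (W n - T n) / a n) \<longlonglongrightarrow> 0"
  proof (rule Lim_null_comparison)
    show "(\<lambda>n. 2 * B\<^sup>2 * (ln (real n) / real n)) \<longlonglongrightarrow> 0" by real_asymp
    show "\<forall>\<^sub>F n in sequentially. norm ((W n - T n) / a n) \<le> 2 * B\<^sup>2 * (ln (real n) / real n)"
      using small a_lower ln_pos a_pos
    proof eventually_elim
      case (elim n)
      have "W n - T n = (\<Sum>i=1..n. ln (1 + (z + e n i) / real n) - (z + e n i) / real n)"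
      proof -
        have "(\<Sum>i=1..n. (z + e n i) / real n) = z + T n"
          using elim by (simp add: T_def sum_divide_distrib[symmetric] sum.distrib add_divide_distrib)
        then show ?thesis by (simp only: W_def sum_subtractf)
      qed
      also have "\<bar>\<dots>\<bar> \<le> (\<Sum>i=1..n. \<bar>ln (1 + (z + e n i) / real n) - (z + e n i) / real n\<bar>)"
        by (rule sum_abs)
      also have "\<dots> \<le> (\<Sum>i=1..n. 2 * (B / real n)\<^sup>2)"
      proof (rule sum_mono)
        fix i assume i: "i \<in> {1..n}"
        with elim have b1: "\<bar>(z + e n i) / real n\<bar> \<le> B / real n" and "B / real n < 1 / 2" by blast+
        then have b: "\<bar>(z + e n i) / real n\<bar> \<le> B / real n" "\<bar>(z + e n i) / real n\<bar> \<le> 1 / 2" by linarith+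
        have "\<bar>ln (1 + (z + e n i) / real n) - (z + e n i) / real n\<bar> \<le> 2 * ((z + e n i) / real n)\<^sup>2"
          by (rule abs_ln_one_plus_x_minus_x_bound[OF b(2)])
        also have "\<dots> \<le> 2 * (B / real n)\<^sup>2"
          using power_mono[OF b(1), of 2] by (simp only: power2_abs) simp
        finally show "\<bar>ln (1 + (z + e n i) / real n) - (z + e n i) / real n\<bar> \<le> 2 * (B / real n)\<^sup>2" .
      qed
      also have "\<dots> = 2 * B\<^sup>2 / real n" using elim by (simp add: power2_eq_square)
      finally have 1: "\<bar>W n - T n\<bar> \<le> 2 * B\<^sup>2 / real n" .
      have "1 / a n \<le> ln (real n)" using elim by (simp add: field_simps)
      then have "\<bar>W n - T n\<bar> * (1 / a n) \<le> 2 * B\<^sup>2 / real n * ln (real n)"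
        using 1 elim by (intro mult_mono) auto
      then show ?case using elim by simp
    qed
  qed
  then have "(\<lambda>n. (W n - T n) / a n + T n / a n) \<longlonglongrightarrow> 0 + K" by (intro tendsto_add T)
  then have "(\<lambda>n. W n / a n) \<longlonglongrightarrow> K" by (simp add: diff_divide_distrib)
  from exp_increment_limit[OF this a a_pos]
  have "(\<lambda>n. (exp (W n) - 1) / a n * exp z) \<longlonglongrightarrow> K * exp z" by (intro tendsto_mult tendsto_const)
  moreover have "\<forall>\<^sub>F n in sequentially. (exp (W n) - 1) / a n * exp z
      = inverse (a n) * ((\<Prod>i\<in>{1..n}. 1 + (z + e n i) / real n) - exp z)"
    using small
  proof eventually_elim
    case (elim n)
    have "exp (W n) * exp z = exp (\<Sum>i=1..n. ln (1 + (z + e n i) / real n))"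
      by (simp add: W_def mult_exp_exp)
    also have "\<dots> = (\<Prod>i\<in>{1..n}. exp (ln (1 + (z + e n i) / real n)))"
      by (simp add: exp_sum)
    also have "\<dots> = (\<Prod>i\<in>{1..n}. 1 + (z + e n i) / real n)"
    proof (rule prod.cong)
      fix i assume "i \<in> {1..n}"
      with elim have "\<bar>(z + e n i) / real n\<bar> \<le> B / real n" "B / real n < 1 / 2" by blast+
      then have "\<bar>(z + e n i) / real n\<bar> < 1 / 2" by linarith
      then show "exp (ln (1 + (z + e n i) / real n)) = 1 + (z + e n i) / real n"
        by (intro exp_ln) linarith
    qed simp
    finally show ?case by (simp add: divide_inverse algebra_simps)
  qed
  ultimately show ?thesis by (rule Lim_transform_eventually)
qed

section \<open>The expansion of the distribution of the maxima\<close>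

theorem theorem2p2:
  fixes M :: "nat \<Rightarrow> 'a measure"
    and F1 F2 :: "real \<Rightarrow> real"
    and X Y :: "nat \<Rightarrow> nat \<Rightarrow> 'a \<Rightarrow> real"
    and \<rho> :: "nat \<Rightarrow> nat \<Rightarrow> real"
    and m :: "nat \<Rightarrow> real \<Rightarrow> real"
    and x y :: real
  assumes F1: "continuous_distribution_function F1"
    and F2: "continuous_distribution_function F2"
    and array: "\<forall>\<^sub>F n in sequentially. normal_copula_row (M n) F1 F2 n (\<rho> n) (X n) (Y n)"
    and m_nonneg: "\<And>n i. i \<in> {1..n} \<Longrightarrow> 0 \<le> m n (real i / real n)"
    and m_min: "filterlim (\<lambda>n. MIN i\<in>{1..n}. m n (real i / real n)) at_top sequentially"
    and m_max: "(\<lambda>n. (MAX i\<in>{1..n}. m n (real i / real n)) / ln (ln (real n))) \<longlonglongrightarrow> 0"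
    and rho: "\<forall>\<^sub>F n in sequentially. \<forall>i\<in>{1..n}. \<rho> n i = 1 - m n (real i / real n) / ln (real n)"
    and x: "x < 0"
    and y: "y < 0"
  shows "(\<lambda>n. inverse (1 / real n *
                (\<Sum>i=1..n. exp (- m n (real i / real n) / 2) / sqrt (m n (real i / real n))))
              * (normalized_maxima_cdf (M n) F1 F2 n (X n) (Y n) x y - exp (x + y)))
         \<longlonglongrightarrow> sqrt (2 / pi) * (x * y) powr (1 / 2) * exp (x + y)"
proof -
  define p where "p n = std_normal_quantile (1 - (- x) / real n)" for n :: nat
  define q where "q n = std_normal_quantile (1 - (- y) / real n)" for n :: nat
  have quantile: "\<forall>\<^sub>F n in sequentially. normal_tail (std_normal_quantile (1 - s / real n)) = s / real n"
    if "0 < s" for s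
  proof -
    have "(\<lambda>n. s / real n) \<longlonglongrightarrow> 0" by real_asymp
    then have "\<forall>\<^sub>F n in sequentially. s / real n < 1" by (rule order_tendstoD) simp
    with eventually_gt_at_top[of 0] show ?thesis
      by eventually_elim (use that in \<open>simp add: normal_tail_quantile\<close>)
  qed
  have p: "\<forall>\<^sub>F n in sequentially. normal_tail (p n) = (- x) / real n"
    unfolding p_def using x by (intro quantile) simp
  have q: "\<forall>\<^sub>F n in sequentially. normal_tail (q n) = (- y) / real n"
    unfolding q_def using y by (intro quantile) simp
  define \<mu> where "\<mu> n i = m n (real i / real n)" for n i
  define g where "g n i = exp (- \<mu> n i / 2) / sqrt (\<mu> n i)" for n i
  define e where "e n i = real n * joint_tail (\<rho> n i) (p n) (q n)" for n i
  define K where "K = sqrt (2 / pi) * sqrt (- x * - y)"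
  have \<mu>_bounds: "(MIN i\<in>{1..n}. \<mu> n i) \<le> \<mu> n i" "\<mu> n i \<le> (MAX i\<in>{1..n}. \<mu> n i)" if "i \<in> {1..n}" for n i
    using that by (auto intro!: Min_le Max_ge)
  have LL: "filterlim (\<lambda>n. ln (ln (real n))) at_top sequentially" by real_asymp
  have LL_pos: "\<forall>\<^sub>F n :: nat in sequentially. 0 < ln (ln (real n))"
    by (rule eventually_compose_filterlim[OF eventually_gt_at_top LL])
  have min_top: "filterlim (\<lambda>n. MIN i\<in>{1..n}. \<mu> n i) at_top sequentially"
    using m_min by (simp add: \<mu>_def)
  have \<mu>_large: "\<forall>\<^sub>F n in sequentially. \<forall>i\<in>{1..n}. C \<le> \<mu> n i" for C
    using eventually_compose_filterlim[OF eventually_ge_at_top[of C] min_top]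
    by eventually_elim (use \<mu>_bounds(1) in \<open>force intro: order_trans\<close>)
  have \<mu>_le: "\<forall>\<^sub>F n in sequentially. \<forall>i\<in>{1..n}. \<mu> n i \<le> ln (ln (real n))"
    using order_tendstoD(2)[OF m_max zero_less_one] LL_pos
  proof eventually_elim
    case (elim n)
    then have "(MAX i\<in>{1..n}. \<mu> n i) \<le> ln (ln (real n))" by (simp add: \<mu>_def)
    then show ?case using \<mu>_bounds(2) by (force intro: order_trans)
  qed
  have "(\<lambda>n. inverse (1 / real n * (\<Sum>i=1..n. g n i)) *
      ((\<Prod>i\<in>{1..n}. 1 + (x + y + e n i) / real n) - exp (x + y))) \<longlonglongrightarrow> K * exp (x + y)"
  proof (rule triangular_product_limit)
    fix \<epsilon> :: real assume \<epsilon>: "0 < \<epsilon>"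
    have "\<forall>\<^sub>F c :: real in at_top. exp (- c / 2) < \<epsilon>"
      by (rule order_tendstoD(2)[OF _ \<epsilon>]) real_asymp
    then obtain C where C: "exp (- C / 2) < \<epsilon>" by (metis eventually_at_top_linorder order_refl)
    show "\<forall>\<^sub>F n in sequentially. \<forall>i\<in>{1..n}. g n i < \<epsilon>"
      using \<mu>_large[of "max 1 C"]
    proof eventually_elim
      case (elim n)
      show ?case
      proof
        fix i assume "i \<in> {1..n}"
        with elim have "1 \<le> \<mu> n i" "C \<le> \<mu> n i" by auto
        then have "g n i \<le> exp (- C / 2) / 1"
          unfolding g_def by (intro frac_le) auto
        with C show "g n i < \<epsilon>" by simp
      qed
    qed
    show "\<forall>\<^sub>F n in sequentially. \<forall>i\<in>{1..n}. \<bar>e n i / g n i - K\<bar> < \<epsilon>"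
    proof (rule uniform_over_rows[OF _ \<epsilon>])
      fix j :: "nat \<Rightarrow> nat" assume j: "\<And>n. 0 < n \<Longrightarrow> j n \<in> {1..n}"
      have top: "filterlim (\<lambda>n. \<mu> n (j n)) at_top sequentially"
        by (rule filterlim_at_top_mono[OF min_top eventually_mono[OF eventually_gt_at_top[of 0]]])
           (use \<mu>_bounds(1) j in blast)
      have zero: "(\<lambda>n. \<mu> n (j n) / ln (ln (real n))) \<longlonglongrightarrow> 0"
      proof (rule tendsto_sandwich[OF _ _ tendsto_const m_max])
        show "\<forall>\<^sub>F n in sequentially. 0 \<le> \<mu> n (j n) / ln (ln (real n))"
          using LL_pos eventually_gt_at_top[of 0]
          by eventually_elim (use m_nonneg j in \<open>simp add: \<mu>_def\<close>)
        show "\<forall>\<^sub>F n in sequentially. \<mu> n (j n) / ln (ln (real n))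
            \<le> (MAX i\<in>{1..n}. m n (real i / real n)) / ln (ln (real n))"
          using LL_pos eventually_gt_at_top[of 0]
        proof eventually_elim
          case (elim n)
          then show ?case
            using \<mu>_bounds(2)[OF j, of n] by (intro divide_right_mono) (auto simp: \<mu>_def)
        qed
      qed
      have "(\<lambda>n. sqrt (\<mu> n (j n)) * exp (\<mu> n (j n) / 2) *
          (real n * joint_tail (1 - \<mu> n (j n) / ln (real n)) (p n) (q n))) \<longlonglongrightarrow> K"
        unfolding K_def using x y by (intro joint_tail_limit p q top zero) auto
      moreover have "\<forall>\<^sub>F n in sequentially. sqrt (\<mu> n (j n)) * exp (\<mu> n (j n) / 2) *
          (real n * joint_tail (1 - \<mu> n (j n) / ln (real n)) (p n) (q n)) = e n (j n) / g n (j n)"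
        using rho eventually_gt_at_top[of 0]
      proof eventually_elim
        case (elim n)
        then have \<rho>: "\<rho> n (j n) = 1 - \<mu> n (j n) / ln (real n)" using j by (simp add: \<mu>_def)
        show ?case unfolding e_def g_def \<rho> by (simp add: exp_minus field_simps)
      qed
      ultimately show "(\<lambda>n. e n (j n) / g n (j n)) \<longlonglongrightarrow> K" by (rule Lim_transform_eventually)
    qed
  next
    show "\<forall>\<^sub>F n in sequentially. \<forall>i\<in>{1..n}. 1 / ln (real n) \<le> g n i"
      using \<mu>_large[of 1] \<mu>_le LL_pos
    proof eventually_elim
      case (elim n)
      show ?case
      proof
        fix i assume i: "i \<in> {1..n}"
        with elim have \<mu>: "1 \<le> \<mu> n i" "\<mu> n i \<le> ln (ln (real n))" by auto
        have "0 \<le> ln (real n)" by (cases n) auto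
        moreover have "ln (real n) \<noteq> 0" using elim by auto
        ultimately have ln_pos: "0 < ln (real n)" by simp
        \<comment> \<open>The denominator \<open>sqrt \<mu>\<close> costs at most another factor \<open>exp (- \<mu> / 2)\<close>.\<close>
        have "\<mu> n i \<le> exp (\<mu> n i)" using exp_ge_add_one_self[of "\<mu> n i"] by linarith
        also have "\<dots> = (exp (\<mu> n i / 2))\<^sup>2" by (simp add: power2_eq_square mult_exp_exp)
        finally have "sqrt (\<mu> n i) \<le> exp (\<mu> n i / 2)" by (intro real_le_lsqrt) auto
        then have "exp (- \<mu> n i / 2) / exp (\<mu> n i / 2) \<le> g n i"
          unfolding g_def using \<mu> by (intro divide_left_mono) auto
        also have "exp (- \<mu> n i / 2) / exp (\<mu> n i / 2) = exp (- \<mu> n i)"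
          by (simp add: exp_diff[symmetric])
        finally have "exp (- \<mu> n i) \<le> g n i" .
        moreover have "exp (- ln (ln (real n))) \<le> exp (- \<mu> n i)" using \<mu> by simp
        moreover have "exp (- ln (ln (real n))) = 1 / ln (real n)"
          using ln_pos by (simp add: exp_minus inverse_eq_divide)
        ultimately show "1 / ln (real n) \<le> g n i" by linarith
      qed
    qed
  qed
  moreover have "K = sqrt (2 / pi) * (x * y) powr (1 / 2)"
    using x y by (simp add: K_def powr_half_sqrt mult_nonpos_nonpos)
  moreover have "\<forall>\<^sub>F n in sequentially. inverse (1 / real n * (\<Sum>i=1..n. g n i)) *
      ((\<Prod>i\<in>{1..n}. 1 + (x + y + e n i) / real n) - exp (x + y))
    = inverse (1 / real n *
                (\<Sum>i=1..n. exp (- m n (real i / real n) / 2) / sqrt (m n (real i / real n))))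
              * (normalized_maxima_cdf (M n) F1 F2 n (X n) (Y n) x y - exp (x + y))"
    using array p q eventually_gt_at_top[of 0]
      eventually_compose_filterlim[OF eventually_gt_at_top[of 0] normal_quantile_at_top[OF p]]
  proof eventually_elim
    case (elim n)
    from normalized_maxima_cdf_eq_prod[OF elim(1) F1 F2 elim(4,5,2,3)]
    show ?case by (simp only: e_def g_def \<mu>_def)
  qed
  ultimately show ?thesis by (simp only:) (rule Lim_transform_eventually)
qed

end
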